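(* Let $n\ge 1$ and let $t,a,b,t_0,t_1,t_2,t_3$ be complex parameters of modulus less than $1$. For all partitions $\lambda,\mu$ with $l(\lambda),l(\mu)\le n$, $$\int_{T} K_{\lambda}^{(n)}(z;t;a,b; t_{0}, \dots, t_{3})\, K_{\mu}^{(n)}(z;t;a,b; t_{0}, \dots, t_{3})\, \tilde \Delta_{K}^{(n)}(z;t;t_{0}, \dots, t_{3})\, dT = N_{\lambda}(t;t_{0}, \dots, t_{3})\, \delta_{\lambda \mu},$$ where $\delta_{\lambda\mu}$ is the Kronecker delta.
   Context: A partition $\lambda=(\lambda_1,\dots,\lambda_n)$ with $l(\lambda)\le n$ is a non-increasing string of $n$ non-negative integers (zeros allowed); $l(\lambda)$ is the number of nonzero parts, and $m_i(\lambda)$ is the number of indices $j\in\{1,\dots,n\}$ with $\lambda_j=i$, for $i\ge 0$. $T=T_n=\{(z_1,\dots,z_n):|z_1|=\dots=|z_n|=1\}$ is the $n$-torus and $dT=\prod_{j=1}^n\frac{dz_j}{2\pi\sqrt{-1}\,z_j}$. The hyperoctahedral group $B_n$ consists of pairs (permutation $\rho\in S_n$, signs $\epsilon_\rho(i)\in\{\pm1\}$), acting on functions of $z_1,\dots,z_n$ by $z_i\mapsto z_{\rho(i)}^{\epsilon_\rho(i)}$. Define $$v_{\lambda}(t;a,b;t_{0}, \dots, t_{3}) = \Bigg( \prod_{i \geq 0} \prod_{j=1}^{m_{i}(\lambda)} \frac{1- t^{j}}{1-t} \Bigg) \prod_{i=1}^{m_{1}(\lambda)} (1- t_{0}t_{1}t_{2}t_{3}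 t^{i-1+2m_{0}(\lambda)}) \prod_{i=1}^{m_{0}(\lambda)} (1-ab\, t^{i-1}),$$ $$v_{\lambda+}(t;t_{0}, \dots, t_{3}) = \Bigg( \prod_{i \geq 1} \prod_{j=1}^{m_{i}(\lambda)} \frac{1- t^{j}}{1-t} \Bigg) \prod_{i=1}^{m_{1}(\lambda)} (1- t_{0}t_{1}t_{2}t_{3} t^{i-1+2m_{0}(\lambda)}),$$ $$K_\lambda^{(n)}(z;t;a,b;t_0,\dots,t_3)= \frac{1}{v_{\lambda}(t;a,b;t_{0}, \dots, t_{3})} \sum_{w \in B_{n}} w \Bigg( \prod_{1 \leq i \leq n} u_{\lambda}(z_{i}) \prod_{1 \leq i<j \leq n} \frac{1-tz_{i}^{-1}z_{j}}{1-z_{i}^{-1}z_{j}}\, \frac{1-tz_{i}^{-1}z_{j}^{-1}}{1-z_{i}^{-1}z_{j}^{-1}} \Bigg),$$ where $$u_\lambda(z_i)=\frac{(1-az_i^{-1})(1-bz_i^{-1})}{1-z_i^{-2}}\ \text{ if }\lambda_i=0,\qquad u_\lambda(z_i)=z_i^{\lambda_i}\,\frac{(1-t_0z_i^{-1})(1-t_1z_i^{-1})(1-t_2z_i^{-1})(1-t_3z_i^{-1})}{1-z_i^{-2}}\ \text{ if }\lambda_i>0.$$ The symmetric Koornwinder density at $q=0$ in $m$ variables is $$\tilde \Delta_{K}^{(m)}(z;t;t_{0},\dots,t_{3}) = \frac{1}{2^{m}m!} \prod_{1 \leq i \leq m} \frac{(1-z_{i}^{\pm 2})}{(1-t_{0}z_{i}^{\pm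 1})(1-t_{1}z_{i}^{\pm 1})(1-t_{2}z_{i}^{\pm 1})(1-t_{3}z_{i}^{\pm 1})} \prod_{1 \leq i<j \leq m} \frac{(1-z_{i}^{\pm 1}z_{j}^{\pm 1})}{(1-tz_{i}^{\pm 1}z_{j}^{\pm 1})},$$ where a factor with $\pm$ exponents denotes the product over all sign choices, e.g. $(1-z_{i}^{\pm 1}z_{j}^{\pm 1})=(1-z_{i}z_{j})(1-z_{i}^{-1}z_{j}^{-1})(1-z_{i}^{-1}z_{j})(1-z_{i}z_{j}^{-1})$. Finally $$N_{\lambda}(t;t_{0}, \dots, t_{3}) = \frac{1}{v_{\lambda+}(t;t_0,\dots,t_3)} \int_{T_{m_0(\lambda)}} \tilde \Delta_{K}^{(m_{0}(\lambda))}(z;t;t_{0}, \dots, t_{3})\, dT,$$ the integral being interpreted as $1$ when $m_0(\lambda)=0$. *)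

theory Defs
  imports "HOL-Probability.Probability" "HOL-Combinatorics.Permutations"
begin

text \<open>
  Variables and parts are indexed from 0: the mathematical index \<open>i \<in> {1,\<dots>,n}\<close> is
  \<open>i - 1 \<in> {..<n}\<close> here.  A point \<open>(z\<^sub>1,\<dots>,z\<^sub>n)\<close> is a function \<open>nat \<Rightarrow> complex\<close> of which only
  the values on \<open>{..<n}\<close> matter.  A partition with at most \<open>n\<close> nonzero parts is the list of
  its \<open>n\<close> parts, zeros included, so the list has length exactly \<open>n\<close>.
\<close>

definition partitions :: "nat \<Rightarrow> nat list set" where
  "partitions n = {lam. length lam = n \<and> sorted_wrt (\<ge>) lam}"

definition part_mult :: "nat \<Rightarrow> nat list \<Rightarrow> nat" where
  "part_mult i lam = card {j. j < length lam \<and> lam ! j = i}"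

text \<open>
  On \<open>|z| = 1\<close> we put \<open>z = exp(\<i>\<theta>)\<close> with \<open>0 \<le> \<theta> \<le> 2\<pi>\<close>, so that
  \<open>dz / (2\<pi>\<i>z) = d\<theta> / (2\<pi>)\<close>.  Hence \<open>dT\<close> is the \<open>n\<close>-fold product of the image of the
  uniform distribution on \<open>[0, 2\<pi>]\<close> under \<open>cis\<close>.
\<close>

definition circle_measure :: "complex measure" where
  "circle_measure = distr (uniform_measure lborel {0..2 * pi}) borel cis"

definition torus_measure :: "nat \<Rightarrow> (nat \<Rightarrow> complex) measure" where
  "torus_measure n = PiM {..<n} (\<lambda>_. circle_measure)"

definition hyperoctahedral :: "nat \<Rightarrow> ((nat \<Rightarrow> nat) \<times> (nat \<Rightarrow> int)) set" where
  "hyperoctahedral n = {\<rho>. \<rho> permutes {..<n}} \<times> ({..<n} \<rightarrow>\<^sub>E {1, -1})"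

definition hyperoctahedral_act ::
    "(nat \<Rightarrow> nat) \<times> (nat \<Rightarrow> int) \<Rightarrow> ((nat \<Rightarrow> complex) \<Rightarrow> complex) \<Rightarrow> (nat \<Rightarrow> complex) \<Rightarrow> complex" where
  "hyperoctahedral_act w f = (\<lambda>z. f (\<lambda>i. z (fst w i) powi snd w i))"

text \<open>
  The products over all \<open>i \<ge> 0\<close> (resp. \<open>i \<ge> 1\<close>) only run over the parts that occur in the
  partition: for any other \<open>i\<close> the inner product is empty.
\<close>

definition v_factor :: "complex \<Rightarrow> complex \<Rightarrow> complex \<Rightarrow> complex \<Rightarrow> complex \<Rightarrow> complex \<Rightarrow> complex
    \<Rightarrow> nat list \<Rightarrow> complex" where
  "v_factor t a b t0 t1 t2 t3 lam =
     (\<Prod>i\<in>set lam. \<Prod>j\<in>{1..part_mult i lam}. (1 - t ^ j) / (1 - t))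
     * (\<Prod>i\<in>{1..part_mult 1 lam}. 1 - t0 * t1 * t2 * t3 * t ^ (i - 1 + 2 * part_mult 0 lam))
     * (\<Prod>i\<in>{1..part_mult 0 lam}. 1 - a * b * t ^ (i - 1))"

definition v_plus :: "complex \<Rightarrow> complex \<Rightarrow> complex \<Rightarrow> complex \<Rightarrow> complex
    \<Rightarrow> nat list \<Rightarrow> complex" where
  "v_plus t t0 t1 t2 t3 lam =
     (\<Prod>i\<in>set lam - {0}. \<Prod>j\<in>{1..part_mult i lam}. (1 - t ^ j) / (1 - t))
     * (\<Prod>i\<in>{1..part_mult 1 lam}. 1 - t0 * t1 * t2 * t3 * t ^ (i - 1 + 2 * part_mult 0 lam))"

text \<open>The first numerical argument \<open>k\<close> of \<open>u_factor\<close> is the part \<open>\<lambda>\<^sub>i\<close>.\<close>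

definition u_factor :: "complex \<Rightarrow> complex \<Rightarrow> complex \<Rightarrow> complex \<Rightarrow> complex \<Rightarrow> complex
    \<Rightarrow> nat \<Rightarrow> complex \<Rightarrow> complex" where
  "u_factor a b t0 t1 t2 t3 k x =
     (if k = 0
      then (1 - a * inverse x) * (1 - b * inverse x) / (1 - inverse x ^ 2)
      else x ^ k * ((1 - t0 * inverse x) * (1 - t1 * inverse x)
                  * (1 - t2 * inverse x) * (1 - t3 * inverse x)) / (1 - inverse x ^ 2))"

text \<open>
  \<open>koornwinder_K\<close> is evaluated pointwise.  The individual summands have poles where \<open>z\<^sub>i = \<plusminus>1\<close> or
  \<open>z\<^sub>i = z\<^sub>j\<^sup>\<plusminus>\<^sup>1\<close>; they meet the torus in a null set, so the values that division by zero
  produces there do not affect any integral.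
\<close>

definition koornwinder_K :: "nat \<Rightarrow> complex \<Rightarrow> complex \<Rightarrow> complex \<Rightarrow> complex \<Rightarrow> complex \<Rightarrow> complex \<Rightarrow> complex
    \<Rightarrow> nat list \<Rightarrow> (nat \<Rightarrow> complex) \<Rightarrow> complex" where
  "koornwinder_K n t a b t0 t1 t2 t3 lam z =
     1 / v_factor t a b t0 t1 t2 t3 lam *
     (\<Sum>w\<in>hyperoctahedral n.
        hyperoctahedral_act w
          (\<lambda>y. (\<Prod>i<n. u_factor a b t0 t1 t2 t3 (lam ! i) (y i)) *
                (\<Prod>i<n. \<Prod>j\<in>{i<..<n}.
                   (1 - t * inverse (y i) * y j) / (1 - inverse (y i) * y j) *
                   ((1 - t * inverse (y i) * inverse (y j)) / (1 - inverse (y i) * inverse (y j)))))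
          z)"

definition koornwinder_density :: "nat \<Rightarrow> complex \<Rightarrow> complex \<Rightarrow> complex \<Rightarrow> complex \<Rightarrow> complex
    \<Rightarrow> (nat \<Rightarrow> complex) \<Rightarrow> complex" where
  "koornwinder_density m t t0 t1 t2 t3 z =
     1 / (2 ^ m * fact m) *
     (\<Prod>i<m. \<Prod>s\<in>{1, -1::int}.
        (1 - z i powi (2 * s)) /
        ((1 - t0 * z i powi s) * (1 - t1 * z i powi s)
         * (1 - t2 * z i powi s) * (1 - t3 * z i powi s))) *
     (\<Prod>i<m. \<Prod>j\<in>{i<..<m}. \<Prod>s\<in>{1, -1::int}. \<Prod>s'\<in>{1, -1::int}.
        (1 - z i powi s * z j powi s') / (1 - t * z i powi s * z j powi s'))"

definition koornwinder_N :: "complex \<Rightarrow> complex \<Rightarrow> complex \<Rightarrow> complex \<Rightarrow> complex \<Rightarrow> nat list \<Rightarrow> complex" where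
  "koornwinder_N t t0 t1 t2 t3 lam =
     1 / v_plus t t0 t1 t2 t3 lam *
     (LINT z|torus_measure (part_mult 0 lam). koornwinder_density (part_mult 0 lam) t t0 t1 t2 t3 z)"

text \<open>The integral in \<open>koornwinder_N\<close> equals 1 when no part is zero, as the convention demands.\<close>

lemma koornwinder_integral_0:
  "(LINT z|torus_measure 0. koornwinder_density 0 t t0 t1 t2 t3 z) = 1"
proof -
  have "measure (torus_measure 0) (space (torus_measure 0)) = 1"
    by (simp add: torus_measure_def PiM_empty measure_count_space)
  then show ?thesis
    by (simp add: koornwinder_density_def)
qed

end

theory Submission
  imports Defs "HOL-Complex_Analysis.Cauchy_Integral_Formula" "HOL-Combinatorics.Multiset_Permutations"
begin

text \<open>
  The orthogonality is proved by integrating out one variable at a time, always the one that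
  carries the largest part of the two partitions.

  Since the factor \<open>cross t x y\<close> is invariant under \<open>y \<mapsto> 1/y\<close>, the sum over \<open>B\<^sub>n\<close> can be carried
  out from the first part on: choose the variable \<open>z\<^sub>k\<^sup>\<plusminus>\<^sup>1\<close> that receives the first part, and sum
  over the arrangements of the others.  This gives the recursion \<open>symsum\<close>, which makes sense for every
  finite set of variables (\<open>hyperoctahedral_sum\<close>).

  Let \<open>l > 0\<close> be the first part of \<open>\<lambda>\<close>, with no part of \<open>\<mu>\<close> above it.  Expand \<open>K\<^sub>\<lambda>\<close> by the recursion, so
  that a variable \<open>x = z\<^sub>k\<close> receives \<open>l\<close>; the two signs contribute equally as the other factors are
  invariant under \<open>x \<mapsto> 1/x\<close>.  The coefficient of this choice, multiplied by the part of the density that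
  contains \<open>x\<close>, is
  \<open>x\<^sup>l (1 - x\<^sup>2) / \<Prod>\<^sub>r (1 - t\<^sub>r x)\<close> times \<open>\<Prod>\<^sub>j (1 - x z\<^sub>j) (1 - x/z\<^sub>j) / ((1 - t x z\<^sub>j) (1 - t x/z\<^sub>j))\<close>,
  which has no pole in the closed unit disc.  Its zeros cancel the poles of \<open>K\<^sub>\<mu>\<close> in \<open>x\<close>, and the factor
  \<open>x\<^sup>l\<close> compensates the powers of \<open>1/x\<close>.  By the mean value property the integral over \<open>x\<close> is the
  value at \<open>0\<close> of the resulting holomorphic function.  This value vanishes unless \<open>\<mu>\<close> starts with \<open>l\<close> as
  well, and otherwise it is a constant times the symmetrised sum of the remaining parts of \<open>\<mu>\<close>
  (\<open>peel_weight_symsum_extends\<close>, \<open>pairing_peel\<close>).  The constants multiply up to \<open>v\<^sub>\<lambda>\<^sub>+\<close>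
  (\<open>v_plus_Cons\<close>).

  What remains are two zero partitions of equal length.  There the symmetrised sum is the constant
  \<open>v_zero\<close>, which makes \<open>K\<close> equal to \<open>1\<close> (\<open>symsum_zero_generic\<close>): this is proved by partial fractions
  (\<open>hyperoctahedral_partial_fractions\<close>).  So the last integral is that of the density.

  All integrands are bounded, because the zeros of the density are exactly strong enough for the square
  of a symmetrised sum (\<open>square_bounded_symsum\<close>).
\<close>

section \<open>Partial fractions over the signed variables\<close>

lemma coeff_mult_degree_bound:
  fixes p q :: "'a::comm_ring_1 poly"
  assumes "degree p \<le> m" "degree q \<le> n"
  shows "coeff (p * q) (m + n) = coeff p m * coeff q n"
proof -
  have "coeff p i * coeff q (m + n - i) = 0" if "i \<in> {..m + n} - {m}" for i
    using that assms by (cases "i < m") (auto simp: coeff_eq_0)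
  then have "(\<Sum>i\<le>m + n. coeff p i * coeff q (m + n - i)) = coeff p m * coeff q (m + n - m)"
    by (subst sum.remove[of _ m]) (auto intro!: sum.neutral)
  then show ?thesis by (simp add: coeff_mult)
qed

lemma coeff_prod_degree_bound:
  fixes f :: "'b \<Rightarrow> 'a::comm_ring_1 poly"
  assumes "finite S" "\<And>i. i \<in> S \<Longrightarrow> degree (f i) \<le> d"
  shows "degree (prod f S) \<le> card S * d \<and> coeff (prod f S) (card S * d) = (\<Prod>i\<in>S. coeff (f i) d)"
  using assms
proof (induction S)
  case (insert x S)
  then have IH: "degree (prod f S) \<le> card S * d" "coeff (prod f S) (card S * d) = (\<Prod>i\<in>S. coeff (f i) d)"
    and dx: "degree (f x) \<le> d" by auto
  have "degree (f x * prod f S) \<le> d + card S * d"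
    using degree_mult_le[of "f x" "prod f S"] IH(1) dx by linarith
  with coeff_mult_degree_bound[OF dx IH(1)] IH insert.hyps show ?case by simp
qed simp

text \<open>
  The left-hand side is the top coefficient of the Lagrange interpolation polynomial of \<open>G\<close>, and \<open>G\<close> is
  its own interpolation polynomial.  It plays the role of the residue theorem for the rational function
  \<open>G / \<Prod>\<^sub>q (y - q)\<close>.
\<close>
lemma lagrange_leading_coeff:
  fixes G :: "'a::field poly"
  assumes fin: "finite Q" and deg: "degree G < card Q"
  shows "(\<Sum>q\<in>Q. poly G q / (\<Prod>r\<in>Q - {q}. q - r)) = coeff G (card Q - 1)"
proof -
  define b where "b q = (\<Prod>r\<in>Q - {q}. [:-r, 1:])" for q :: 'a
  define L where "L = (\<Sum>q\<in>Q. smult (poly G q / (\<Prod>r\<in>Q - {q}. q - r)) (b q))"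
  have b: "degree (b q) \<le> card Q - 1 \<and> coeff (b q) (card Q - 1) = 1" if "q \<in> Q" for q
    using coeff_prod_degree_bound[of "Q - {q}" "\<lambda>r. [:-r, 1:]" 1] fin that by (simp add: b_def)
  have poly_b: "poly (b q) p = (if p = q then \<Prod>r\<in>Q - {q}. q - r else 0)" if "p \<in> Q" "q \<in> Q" for p q
    using that fin by (auto simp: b_def poly_prod intro!: prod_zero)
  have "poly L p = poly G p" if p: "p \<in> Q" for p
  proof -
    have nz: "(\<Prod>r\<in>Q - {p}. p - r) \<noteq> 0" using fin by auto
    have "poly L p = (\<Sum>q\<in>Q. if q = p then poly G p else 0)"
      unfolding L_def poly_sum using nz
      by (intro sum.cong refl) (auto simp: poly_b p)
    then show ?thesis using p fin by simp
  qed
  then have roots: "Q \<subseteq> {x. poly (L - G) x = 0}" by auto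
  have "degree L \<le> card Q - 1"
    unfolding L_def by (intro degree_sum_le fin order.trans[OF degree_smult_le]) (use b in auto)
  then have degLG: "degree (L - G) < card Q"
    using deg by (intro degree_diff_less) auto
  have "L - G = 0"
  proof (rule ccontr)
    assume nz: "L - G \<noteq> 0"
    have "card Q \<le> card {x. poly (L - G) x = 0}"
      using roots nz by (intro card_mono poly_roots_finite) auto
    also have "\<dots> \<le> degree (L - G)" using nz by (rule card_poly_roots_bound)
    finally show False using degLG by simp
  qed
  then have "coeff G (card Q - 1) = coeff L (card Q - 1)" by simp
  also have "\<dots> = (\<Sum>q\<in>Q. poly G q / (\<Prod>r\<in>Q - {q}. q - r))"
    using b by (simp add: L_def coeff_sum)
  finally show ?thesis by simp
qed

text \<open>The interaction of a variable \<open>x\<close> with a variable \<open>y\<close> that comes later in the arrangement.\<close>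
definition cross :: "complex \<Rightarrow> complex \<Rightarrow> complex \<Rightarrow> complex" where
  "cross t x y = (1 - t * inverse x * y) / (1 - inverse x * y) *
     ((1 - t * inverse x * inverse y) / (1 - inverse x * inverse y))"

lemma cross_inverse [simp]: "cross t x (inverse y) = cross t x y"
  by (simp add: cross_def mult.commute)

text \<open>
  The points at which no denominator \<open>1 - z\<^sub>i\<^sup>-\<^sup>2\<close> or \<open>1 - z\<^sub>i\<^sup>-\<^sup>1 z\<^sub>j\<^sup>\<plusminus>\<^sup>1\<close> vanishes, that is, the \<open>z\<^sub>i\<^sup>\<plusminus>\<^sup>1\<close> are pairwise
  distinct.
\<close>
definition generic :: "'i set \<Rightarrow> ('i \<Rightarrow> complex) \<Rightarrow> bool" where
  "generic A z \<longleftrightarrow> (\<forall>i\<in>A. z i \<noteq> 0 \<and> z i ^ 2 \<noteq> 1) \<and>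
     (\<forall>i\<in>A. \<forall>j\<in>A. i \<noteq> j \<longrightarrow> z i \<noteq> z j \<and> z i * z j \<noteq> 1)"

lemma signed_pair_factors:
  fixes y x :: complex assumes "x \<noteq> 0"
  shows "(y - x) * (y - inverse x) = (1 - y * x) * (1 - y * inverse x)"
  using assms by (simp add: field_simps)

text \<open>
  In terms of \<open>y = 1/x\<close>, the summands are up to a constant the residues of
  \<open>(1 - a y) (1 - b y) P(t y) / (y (1 - t y\<^sup>2) P(y))\<close> at the zeros \<open>z\<^sub>k\<^sup>\<plusminus>\<^sup>1\<close> of
  \<open>P(y) = \<Prod>\<^sub>j (1 - y z\<^sub>j) (1 - y/z\<^sub>j)\<close>.  The right-hand side collects the residues at \<open>0\<close>, at \<open>\<infinity>\<close> and at
  \<open>\<plusminus>t\<^sup>-\<^sup>1\<^sup>/\<^sup>2\<close>; the last two are explicit because \<open>P(1/s) = s\<^sup>-\<^sup>2\<^sup>n P(s)\<close>.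
\<close>
lemma hyperoctahedral_partial_fractions_nonzero:
  fixes z :: "'i \<Rightarrow> complex" and t a b :: complex
  assumes fin: "finite A" and ne: "A \<noteq> {}" and gen: "generic A z"
    and t0: "t \<noteq> 0" and t1: "t \<noteq> 1" and tz: "\<And>i. i \<in> A \<Longrightarrow> t * z i ^ 2 \<noteq> 1 \<and> t \<noteq> z i ^ 2"
  shows "(\<Sum>k\<in>A. \<Sum>x\<in>{z k, inverse (z k)}.
            (1 - a * inverse x) * (1 - b * inverse x) / (1 - inverse x ^ 2) *
            (\<Prod>j\<in>A - {k}. cross t x (z j)))
         = (1 - t ^ card A) / (1 - t) * (1 - a * b * t ^ (card A - 1))"
proof -
  define n where "n = card A"
  have n: "n \<ge> 1" using fin ne by (simp add: n_def Suc_le_eq card_gt_0_iff)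
  \<comment> \<open>The points \<open>s\<close> and \<open>- s\<close> are the zeros of \<open>1 - t y\<^sup>2\<close>.\<close>
  define s where "s = inverse (csqrt t)"
  have s2: "s ^ 2 = inverse t" by (simp add: s_def power_inverse)
  have s0: "s \<noteq> 0" using t0 by (simp add: s_def)
  define pq where "pq j = [:1, - (t * z j):] * [:1, - (t * inverse (z j)):]" for j
  \<comment> \<open>\<open>G\<close> is the numerator of the rational function above, and \<open>Q\<close> below is the set of all finite poles.\<close>
  define G where "G = ([:1, -a:] * [:1, -b:]) * (\<Prod>j\<in>A. pq j)"
  have z0: "z i \<noteq> 0" and zz: "z i ^ 2 \<noteq> 1" if "i \<in> A" for i
    using gen that by (auto simp: generic_def)
  have zd: "z i \<noteq> z j" "z i * z j \<noteq> 1" if "i \<in> A" "j \<in> A" "i \<noteq> j" for i j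
    using gen that by (auto simp: generic_def)
  have zinv: "z i \<noteq> inverse (z j)" if "i \<in> A" "j \<in> A" for i j
  proof
    assume "z i = inverse (z j)"
    then have "z i * z j = 1" using z0[OF that(2)] by simp
    then show False using zd(2)[OF that] zz[OF that(1)] by (cases "i = j") (auto simp: power2_eq_square)
  qed
  have injz: "inj_on z A" using zd by (auto simp: inj_on_def)
  have inji: "inj_on (\<lambda>i. inverse (z i)) A" using zd by (auto simp: inj_on_def)
  define P where "P B = z ` B \<union> (\<lambda>i. inverse (z i)) ` B" for B
  have disj: "z ` B \<inter> (\<lambda>i. inverse (z i)) ` B' = {}" if "B \<subseteq> A" "B' \<subseteq> A" for B B'
    using zinv that by blast
  have prodP: "(\<Prod>r\<in>P B. f r) = (\<Prod>j\<in>B. f (z j) * f (inverse (z j)))" if "B \<subseteq> A" for B and f :: "complex \<Rightarrow> complex"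
  proof -
    have "finite B" using fin that by (rule rev_finite_subset)
    moreover have "inj_on z B" "inj_on (\<lambda>i. inverse (z i)) B"
      using injz inji that inj_on_subset by blast+
    ultimately show ?thesis unfolding P_def
      by (subst prod.union_disjoint) (use disj[of B B] that in \<open>auto simp: prod.reindex prod.distrib\<close>)
  qed
  have sumP: "(\<Sum>r\<in>P A. f r) = (\<Sum>j\<in>A. f (z j) + f (inverse (z j)))" for f :: "complex \<Rightarrow> complex"
    unfolding P_def
    by (subst sum.union_disjoint) (use disj[of A A] fin in \<open>auto simp: sum.reindex injz inji sum.distrib\<close>)
  have cardP: "card (P A) = 2 * n"
    unfolding P_def by (subst card_Un_disjoint) (use disj[of A A] fin in \<open>auto simp: card_image injz inji n_def\<close>)
  have finP: "finite (P A)" using fin by (simp add: P_def)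
  have sP: "s \<notin> P A" "- s \<notin> P A"
  proof -
    have "r ^ 2 \<noteq> inverse t" if "r \<in> P A" for r
      using that tz t0 z0 unfolding P_def by (auto simp: power_inverse field_simps)
    then show "s \<notin> P A" "- s \<notin> P A" using s2 power2_minus[of s] by metis+
  qed
  have zP: "0 \<notin> P A" using z0 by (auto simp: P_def)
  define Q where "Q = insert 0 (insert s (insert (-s) (P A)))"
  have finQ: "finite Q" using finP by (simp add: Q_def)
  have cardQ: "card Q = 2 * n + 3" using finP sP zP s0 cardP by (simp add: Q_def)
  have pq: "degree (pq j) \<le> 2" "coeff (pq j) 2 = t ^ 2" if "j \<in> A" for j
    using z0[OF that] by (auto simp: pq_def field_simps numeral_2_eq_2 )
  have dab: "degree ([:1, -a:] * [:1, -b:]) \<le> 2" by simp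
  have prodpq: "degree (prod pq A) \<le> n * 2 \<and> coeff (prod pq A) (n * 2) = (\<Prod>i\<in>A. coeff (pq i) 2)"
    unfolding n_def using fin pq(1) by (rule coeff_prod_degree_bound)
  have dG: "degree G \<le> 2 + n * 2"
    using degree_mult_le[of "[:1, -a:] * [:1, -b:]" "\<Prod>j\<in>A. pq j"] dab prodpq
    unfolding G_def by linarith
  have lcG: "coeff G (2 + n * 2) = a * b * t ^ (2 * n)"
  proof -
    have "coeff G (2 + n * 2) = coeff ([:1, -a:] * [:1, -b:]) 2 * coeff (prod pq A) (n * 2)"
      unfolding G_def by (rule coeff_mult_degree_bound[OF dab]) (use prodpq in simp)
    also have "coeff ([:1, -a:] * [:1, -b:]) 2 = a * b" by (simp add: numeral_2_eq_2)
    also have "coeff (prod pq A) (n * 2) = t ^ (2 * n)"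
      using prodpq pq(2) by (simp add: n_def power_mult)
    finally show ?thesis .
  qed
  have polyG: "poly G y = (1 - a * y) * (1 - b * y) * (\<Prod>j\<in>A. (1 - t * y * z j) * (1 - t * y * inverse (z j)))" for y
    by (simp add: G_def pq_def poly_prod algebra_simps)
  define F where "F q = poly G q / (\<Prod>r\<in>Q - {q}. q - r)" for q
  have lag: "(\<Sum>q\<in>Q. F q) = a * b * t ^ (2 * n)"
    unfolding F_def using lagrange_leading_coeff[OF finQ, of G] dG lcG by (simp add: cardQ mult.commute)
  have F0: "F 0 = - t"
  proof -
    have "Q - {0} = insert s (insert (-s) (P A))" using zP s0 by (auto simp: Q_def)
    then have "(\<Prod>r\<in>Q - {0}. 0 - r) = (- s) * (s * (\<Prod>r\<in>P A. - r))" using sP finP s0 by simp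
    also have "(\<Prod>r\<in>P A. - r) = 1" using z0 by (simp add: prodP)
    finally have "(\<Prod>r\<in>Q - {0}. 0 - r) = - (s ^ 2)" by (simp add: power2_eq_square)
    then show ?thesis by (simp add: F_def polyG s2 divide_inverse)
  qed
  have Fs: "F q = (1 - a * q) * (1 - b * q) * t ^ (n + 1) / 2" if q: "q = s \<or> q = - s" for q
  proof -
    have q2: "q ^ 2 = inverse t" and qn0: "q \<noteq> 0" and qP: "q \<notin> P A" "- q \<notin> P A"
      using q s2 s0 sP by auto
    have tq: "t * q = inverse q" using q2 t0 qn0 by (simp add: field_simps power2_eq_square)
    have "Q = insert q (insert 0 (insert (-q) (P A)))" using q by (auto simp: Q_def)
    then have "Q - {q} = insert 0 (insert (-q) (P A))" using qP qn0 by auto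
    then have "(\<Prod>r\<in>Q - {q}. q - r) = q * (2 * q * (\<Prod>r\<in>P A. q - r))"
      using qP zP finP qn0 by simp
    also have "(\<Prod>r\<in>P A. q - r) = (\<Prod>j\<in>A. (q - z j) * (q - inverse (z j)))" by (simp add: prodP)
    finally have den: "(\<Prod>r\<in>Q - {q}. q - r) = 2 * q ^ 2 * (\<Prod>j\<in>A. (q - z j) * (q - inverse (z j)))"
      by (simp add: power2_eq_square)
    have "(1 - t * q * z j) * (1 - t * q * inverse (z j)) = t * ((q - z j) * (q - inverse (z j)))" for j
    proof -
      have "(1 - inverse q * z j) * (1 - inverse q * inverse (z j)) = inverse (q ^ 2) * ((q - z j) * (q - inverse (z j)))"
      proof -
        have "1 - inverse q * x = inverse q * (q - x)" for x using qn0 by (simp add: algebra_simps)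
        then show ?thesis by (simp add: power2_eq_square)
      qed
      then show ?thesis using tq q2 by simp
    qed
    then have num: "poly G q = (1 - a * q) * (1 - b * q) * (t ^ n * (\<Prod>j\<in>A. (q - z j) * (q - inverse (z j))))"
      by (simp add: polyG prod.distrib n_def)
    have "q - z j \<noteq> 0" "q - inverse (z j) \<noteq> 0" if "j \<in> A" for j
      using qP(1) that by (auto simp: P_def)
    then have "(\<Prod>j\<in>A. (q - z j) * (q - inverse (z j))) \<noteq> 0" using fin by auto
    then show ?thesis using t0 by (simp add: F_def num den q2 field_simps)
  qed
  have "F s + F (- s) = (1 + a * b * s ^ 2) * t ^ (n + 1)"
    by (simp add: Fs field_simps power2_eq_square)
  also have "\<dots> = t ^ (n + 1) + a * b * t ^ n" using t0 by (simp add: s2 field_simps)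
  finally have Fss: "F s + F (- s) = t ^ (n + 1) + a * b * t ^ n" .
  define h where "h k x = (1 - a * inverse x) * (1 - b * inverse x) / (1 - inverse x ^ 2) *
            (\<Prod>j\<in>A - {k}. cross t x (z j))" for k x
  have FP: "F (inverse x) = t * (1 - t) * h k x" if k: "k \<in> A" and x: "x = z k \<or> x = inverse (z k)" for k x
  proof -
    define y where "y = inverse x"
    have x0: "x \<noteq> 0" and y0: "y \<noteq> 0" using x z0[OF k] by (auto simp: y_def)
    have PA: "P A = insert y (insert (inverse y) (P (A - {k})))"
      using k x unfolding P_def y_def by auto
    have ysq: "y ^ 2 = z k ^ 2 \<or> y ^ 2 = inverse (z k ^ 2)"
      using x by (auto simp: y_def power_inverse)
    have y2: "y ^ 2 \<noteq> 1" using ysq zz[OF k] by auto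
    have "t * inverse (z k ^ 2) \<noteq> 1" using tz[OF k] z0[OF k] by (simp add: field_simps)
    then have ty2: "t * y ^ 2 \<noteq> 1" using ysq tz[OF k] by auto
    have yinv: "y \<noteq> inverse y" using y2 y0 by (auto simp: power2_eq_square field_simps)
    have nP: "y \<notin> P (A - {k})" "inverse y \<notin> P (A - {k})"
    proof -
      have "z k \<noteq> z j" "z k \<noteq> inverse (z j)" "inverse (z k) \<noteq> z j" if "j \<in> A - {k}" for j
        using zd(1)[OF k, of j] zinv[OF k, of j] zinv[OF _ k, of j] that by auto
      then have ne: "z k \<noteq> z j" "z k \<noteq> inverse (z j)" "inverse (z k) \<noteq> z j"
          "inverse (z k) \<noteq> inverse (z j)" if "j \<in> A - {k}" for j
        using that by auto
      have "w \<notin> P (A - {k})" if "w = z k \<or> w = inverse (z k)" for w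
      proof
        assume "w \<in> P (A - {k})"
        then obtain j where "j \<in> A - {k}" "w = z j \<or> w = inverse (z j)" by (auto simp: P_def)
        with ne[of j] that show False by auto
      qed
      then show "y \<notin> P (A - {k})" "inverse y \<notin> P (A - {k})" using x by (auto simp: y_def)
    qed
    have yns: "y \<noteq> s" "y \<noteq> - s" "0 \<noteq> inverse y" "s \<noteq> inverse y" "- s \<noteq> inverse y" using sP zP PA by auto
    have nP': "0 \<notin> P (A - {k})" "s \<notin> P (A - {k})" "- s \<notin> P (A - {k})"
      using zP sP PA by auto
    have "Q - {y} = insert 0 (insert s (insert (-s) (insert (inverse y) (P (A - {k})))))"
      using yns nP yinv y0 unfolding Q_def PA by auto
    then have "(\<Prod>r\<in>Q - {y}. y - r) = y * ((y - s) * ((y + s) * ((y - inverse y) * (\<Prod>r\<in>P (A - {k}). y - r))))"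
      using nP' nP yns s0 finP PA by simp
    also have "(\<Prod>r\<in>P (A - {k}). y - r) = (\<Prod>j\<in>A - {k}. (y - z j) * (y - inverse (z j)))"
      by (simp add: prodP)
    also have "\<dots> = (\<Prod>j\<in>A - {k}. (1 - y * z j) * (1 - y * inverse (z j)))"
      by (intro prod.cong refl signed_pair_factors) (use z0 in auto)
    also have "y * ((y - s) * ((y + s) * ((y - inverse y) * W))) = (1 - t * y ^ 2) * (1 - y ^ 2) / t * W" for W
    proof -
      have e1: "y * (y - inverse y) = - (1 - y ^ 2)" using y0 by (simp add: field_simps power2_eq_square)
      have e2: "(y - s) * (y + s) = - (1 - t * y ^ 2) / t"
        using s2 t0 by (simp add: field_simps power2_eq_square)
      have "y * ((y - s) * ((y + s) * ((y - inverse y) * W))) = (y * (y - inverse y)) * ((y - s) * (y + s)) * W"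
        by (simp only: ac_simps)
      then show ?thesis unfolding e1 e2 by (simp add: algebra_simps)
    qed
    finally have den: "(\<Prod>r\<in>Q - {y}. y - r) = (1 - t * y ^ 2) * (1 - y ^ 2) / t *
        (\<Prod>j\<in>A - {k}. (1 - y * z j) * (1 - y * inverse (z j)))" .
    have "(1 - t * y * z k) * (1 - t * y * inverse (z k)) = (1 - t * y ^ 2) * (1 - t)"
      using x z0[OF k] by (auto simp: y_def power2_eq_square mult.assoc)
    then have num: "poly G y = (1 - a * y) * (1 - b * y) * ((1 - t * y ^ 2) * (1 - t) *
        (\<Prod>j\<in>A - {k}. (1 - t * y * z j) * (1 - t * y * inverse (z j))))"
      unfolding polyG using fin k by (simp add: prod.remove)
    have "(\<Prod>j\<in>A - {k}. cross t x (z j)) = (\<Prod>j\<in>A - {k}. (1 - t * y * z j) * (1 - t * y * inverse (z j)))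
        / (\<Prod>j\<in>A - {k}. (1 - y * z j) * (1 - y * inverse (z j)))"
      by (simp add: cross_def y_def prod_dividef)
    then show ?thesis using t0 ty2
      unfolding F_def h_def y_def[symmetric] num den by simp
  qed
  have "(\<Sum>q\<in>P A. F q) = (\<Sum>k\<in>A. t * (1 - t) * (h k (z k) + h k (inverse (z k))))"
    unfolding sumP
  proof (intro sum.cong refl)
    fix k assume "k \<in> A"
    then show "F (z k) + F (inverse (z k)) = t * (1 - t) * (h k (z k) + h k (inverse (z k)))"
      using FP[of k "z k"] FP[of k "inverse (z k)"] by (simp add: distrib_left)
  qed
  also have "\<dots> = t * (1 - t) * (\<Sum>k\<in>A. h k (z k) + h k (inverse (z k)))"
    by (simp add: sum_distrib_left)
  finally have "t * (1 - t) * (\<Sum>k\<in>A. h k (z k) + h k (inverse (z k))) = (\<Sum>q\<in>P A. F q)" by simp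
  also have "(\<Sum>q\<in>Q. F q) = F 0 + (F s + (F (-s) + (\<Sum>q\<in>P A. F q)))"
    unfolding Q_def using zP sP s0 finP by simp
  then have "(\<Sum>q\<in>P A. F q) = a * b * t ^ (2 * n) + t - t ^ (n + 1) - a * b * t ^ n"
    using lag F0 Fss by (simp add: algebra_simps)
  also have "\<dots> = t * ((1 - t ^ n) * (1 - a * b * t ^ (n - 1)))"
    using n by (cases n) (simp_all add: algebra_simps power_mult power2_eq_square)
  finally have "(1 - t) * (\<Sum>k\<in>A. h k (z k) + h k (inverse (z k))) = (1 - t ^ n) * (1 - a * b * t ^ (n - 1))"
    using t0 by (simp add: mult.assoc)
  then have "(\<Sum>k\<in>A. h k (z k) + h k (inverse (z k))) = (1 - t ^ n) / (1 - t) * (1 - a * b * t ^ (n - 1))"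
    using t1 by (simp add: field_simps)
  moreover have "(\<Sum>x\<in>{z k, inverse (z k)}. h k x) = h k (z k) + h k (inverse (z k))" if "k \<in> A" for k
    using zinv[OF that that] by simp
  ultimately show ?thesis unfolding h_def n_def by simp
qed

text \<open>
  Both sides are continuous in \<open>t\<close> near \<open>0\<close>, so the case \<open>t = 0\<close>, where the poles \<open>\<plusminus>t\<^sup>-\<^sup>1\<^sup>/\<^sup>2\<close> disappear to
  infinity, follows from the other ones.  On the torus the conditions that separate \<open>\<plusminus>t\<^sup>-\<^sup>1\<^sup>/\<^sup>2\<close> from the
  \<open>z\<^sub>k\<^sup>\<plusminus>\<^sup>1\<close> hold because \<open>|t| < 1\<close>.
\<close>
lemma hyperoctahedral_partial_fractions:
  fixes z :: "'i \<Rightarrow> complex" and t a b :: complex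
  assumes fin: "finite A" and ne: "A \<noteq> {}" and gen: "generic A z"
    and t: "norm t < 1" and z: "\<And>i. i \<in> A \<Longrightarrow> norm (z i) = 1"
  shows "(\<Sum>k\<in>A. \<Sum>x\<in>{z k, inverse (z k)}.
            (1 - a * inverse x) * (1 - b * inverse x) / (1 - inverse x ^ 2) *
            (\<Prod>j\<in>A - {k}. cross t x (z j)))
         = (1 - t ^ card A) / (1 - t) * (1 - a * b * t ^ (card A - 1))"
proof -
  define L where "L \<tau> = (\<Sum>k\<in>A. \<Sum>x\<in>{z k, inverse (z k)}.
            (1 - a * inverse x) * (1 - b * inverse x) / (1 - inverse x ^ 2) *
            (\<Prod>j\<in>A - {k}. cross \<tau> x (z j)))" for \<tau>
  define R where "R \<tau> = (1 - \<tau> ^ card A) / (1 - \<tau>) * (1 - a * b * \<tau> ^ (card A - 1))" for \<tau>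
  have eq: "L \<tau> = R \<tau>" if "\<tau> \<noteq> 0" "norm \<tau> < 1" for \<tau>
    unfolding L_def R_def
  proof (rule hyperoctahedral_partial_fractions_nonzero[OF fin ne gen that(1)])
    show "\<tau> \<noteq> 1" using that(2) by auto
    fix i assume "i \<in> A"
    then have "norm (\<tau> * z i ^ 2) < 1" "norm (z i ^ 2) = 1"
      using z that(2) by (auto simp: norm_mult norm_power)
    then show "\<tau> * z i ^ 2 \<noteq> 1 \<and> \<tau> \<noteq> z i ^ 2" using that(2) by auto
  qed
  show ?thesis
  proof (cases "t = 0")
    case False
    then show ?thesis using eq t by (simp add: L_def R_def)
  next
    case True
    have "isCont L 0" unfolding L_def cross_def divide_inverse by (intro continuous_intros)
    then have L: "L \<midarrow>0\<rightarrow> L 0" by (simp add: isCont_def)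
    have "isCont R 0" unfolding R_def by (intro continuous_intros) auto
    then have "R \<midarrow>0\<rightarrow> R 0" by (simp add: isCont_def)
    moreover have "eventually (\<lambda>\<tau>. R \<tau> = L \<tau>) (at 0)"
      unfolding eventually_at by (rule exI[of _ 1]) (auto simp: eq)
    ultimately have "L \<midarrow>0\<rightarrow> R 0" by (rule Lim_transform_eventually)
    with L have "L 0 = R 0" by (rule LIM_unique)
    then show ?thesis using True by (simp add: L_def R_def)
  qed
qed

section \<open>The symmetrised sum as a recursion\<close>

locale koornwinder =
  fixes t a b t0 t1 t2 t3 :: complex
  assumes norm_t: "norm t < 1" and norm_a: "norm a < 1" and norm_b: "norm b < 1"
    and norm_t0: "norm t0 < 1" and norm_t1: "norm t1 < 1" and norm_t2: "norm t2 < 1"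
    and norm_t3: "norm t3 < 1"
begin

text \<open>The factors of a summand that contain \<open>x\<close> if \<open>x\<close> receives the first part \<open>l\<close> and the variables with index in \<open>B\<close> follow.\<close>
definition branch :: "nat \<Rightarrow> complex \<Rightarrow> nat set \<Rightarrow> (nat \<Rightarrow> complex) \<Rightarrow> complex" where
  "branch l x B z = u_factor a b t0 t1 t2 t3 l x * (\<Prod>j\<in>B. cross t x (z j))"

text \<open>
  The unnormalised \<open>K\<close> in the variables with index in \<open>A\<close>.  The signs of the later variables do not enter
  \<open>branch\<close>, so each choice of a signed first variable splits off as a factor.
\<close>
fun symsum :: "nat list \<Rightarrow> nat set \<Rightarrow> (nat \<Rightarrow> complex) \<Rightarrow> complex" where
  "symsum [] A z = 1"
| "symsum (l # lam) A z =
     (\<Sum>k\<in>A. (branch l (z k) (A - {k}) z + branch l (inverse (z k)) (A - {k}) z)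
        * symsum lam (A - {k}) z)"

text \<open>The normalising factor \<open>v\<close> of the zero partition of length \<open>m\<close>.\<close>
definition v_zero :: "nat \<Rightarrow> complex" where
  "v_zero m = (\<Prod>j\<in>{1..m}. (1 - t ^ j) / (1 - t)) * (\<Prod>i\<in>{1..m}. 1 - a * b * t ^ (i - 1))"

text \<open>
  Macdonald's summation over \<open>B\<^sub>m\<close> for the zero partition: each step of the recursion multiplies the sum
  by the value of one partial fraction expansion.
\<close>
lemma symsum_zero_generic:
  assumes "finite A" "generic A z" "\<And>i. i \<in> A \<Longrightarrow> norm (z i) = 1" "card A = m"
  shows "symsum (replicate m 0) A z = v_zero m"
  using assms
proof (induction m arbitrary: A)
  case (Suc m)
  have ne: "A \<noteq> {}" using Suc.prems by auto
  have IH: "symsum (replicate m 0) (A - {k}) z = v_zero m" if "k \<in> A" for k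
    using Suc.prems that by (intro Suc.IH) (auto simp: generic_def)
  have "z k \<noteq> inverse (z k)" if "k \<in> A" for k
    using Suc.prems(2) that unfolding generic_def
    by (metis power2_eq_square right_inverse)
  then have "symsum (replicate (Suc m) 0) A z = (\<Sum>k\<in>A. \<Sum>x\<in>{z k, inverse (z k)}.
            (1 - a * inverse x) * (1 - b * inverse x) / (1 - inverse x ^ 2) *
            (\<Prod>j\<in>A - {k}. cross t x (z j))) * v_zero m"
    by (subst sum_distrib_right) (simp add: IH branch_def u_factor_def)
  also have "\<dots> = (1 - t ^ Suc m) / (1 - t) * (1 - a * b * t ^ m) * v_zero m"
    by (subst hyperoctahedral_partial_fractions) (use Suc.prems ne norm_t in simp_all)
  also have "\<dots> = v_zero (Suc m)"
    by (simp add: v_zero_def)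
  finally show ?case .
qed (simp add: v_zero_def)

definition branches :: "nat \<Rightarrow> nat \<Rightarrow> nat set \<Rightarrow> (nat \<Rightarrow> complex) \<Rightarrow> complex" where
  "branches l k B z = branch l (z k) B z + branch l (inverse (z k)) B z"

lemma symsum_Cons:
  "symsum (l # lam) A z = (\<Sum>k\<in>A. branches l k (A - {k}) z * symsum lam (A - {k}) z)"
  by (simp add: branches_def)

text \<open>Unfolding the recursion: a list \<open>xs\<close> records which variable receives which part.\<close>
lemma symsum_permutations:
  assumes "finite A" "length lam = card A"
  shows "symsum lam A z = (\<Sum>xs\<in>permutations_of_set A.
    \<Prod>i<length lam. branches (lam ! i) (xs ! i) (set (drop (Suc i) xs)) z)"
  using assms
proof (induction lam arbitrary: A)
  case (Cons l lam)
  define W where "W lam xs = (\<Prod>i<length lam. branches (lam ! i) (xs ! i) (set (drop (Suc i) xs)) z)"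
    for lam xs
  have W_Cons: "W (l # lam) (k # xs) = branches l k (set xs) z * W lam xs" for k xs
    by (simp add: W_def prod.lessThan_Suc_shift del: prod.lessThan_Suc)
  have "A \<noteq> {}" using Cons.prems by auto
  then have "(\<Sum>xs\<in>permutations_of_set A. W (l # lam) xs)
      = (\<Sum>k\<in>A. \<Sum>xs\<in>(#) k ` permutations_of_set (A - {k}). W (l # lam) xs)"
    unfolding permutations_of_set_nonempty[OF \<open>A \<noteq> {}\<close>]
    by (intro sum.UNION_disjoint) (use Cons.prems in auto)
  also have "\<dots> = (\<Sum>k\<in>A. branches l k (A - {k}) z * symsum lam (A - {k}) z)"
  proof (intro sum.cong refl)
    fix k assume k: "k \<in> A"
    have "(\<Sum>xs\<in>(#) k ` permutations_of_set (A - {k}). W (l # lam) xs)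
        = (\<Sum>xs\<in>permutations_of_set (A - {k}). branches l k (A - {k}) z * W lam xs)"
      by (subst sum.reindex) (auto intro!: sum.cong simp: W_Cons permutations_of_set_def)
    also have "\<dots> = branches l k (A - {k}) z * symsum lam (A - {k}) z"
    proof -
      have "symsum lam (A - {k}) z = (\<Sum>xs\<in>permutations_of_set (A - {k}). W lam xs)"
        unfolding W_def by (rule Cons.IH) (use Cons.prems k in auto)
      then show ?thesis by (simp only: sum_distrib_left)
    qed
    finally show "(\<Sum>xs\<in>(#) k ` permutations_of_set (A - {k}). W (l # lam) xs)
        = branches l k (A - {k}) z * symsum lam (A - {k}) z" .
  qed
  finally show ?case by (simp only: W_def symsum_Cons)
qed simp

text \<open>Injectivity suffices, as both sets have \<open>n!\<close> elements.\<close>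
lemma bij_betw_permutes_lists:
  "bij_betw (\<lambda>\<rho>. map \<rho> [0..<n]) {\<rho>. \<rho> permutes {..<n}} (permutations_of_set {..<n})"
proof (rule bij_betw_imageI)
  show inj: "inj_on (\<lambda>\<rho>. map \<rho> [0..<n]) {\<rho>. \<rho> permutes {..<n}}"
  proof (rule inj_onI)
    fix \<rho> \<sigma> assume *: "\<rho> \<in> {\<rho>. \<rho> permutes {..<n}}" "\<sigma> \<in> {\<rho>. \<rho> permutes {..<n}}"
      "map \<rho> [0..<n] = map \<sigma> [0..<n]"
    show "\<rho> = \<sigma>"
    proof
      fix i show "\<rho> i = \<sigma> i"
        using * permutes_not_in[of \<rho> "{..<n}" i] permutes_not_in[of \<sigma> "{..<n}" i] by (cases "i < n") auto
    qed
  qed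
  show "(\<lambda>\<rho>. map \<rho> [0..<n]) ` {\<rho>. \<rho> permutes {..<n}} = permutations_of_set {..<n}"
  proof (rule card_subset_eq)
    show "(\<lambda>\<rho>. map \<rho> [0..<n]) ` {\<rho>. \<rho> permutes {..<n}} \<subseteq> permutations_of_set {..<n}"
      by (intro image_subsetI)
        (simp add: permutations_of_set_def distinct_map permutes_image permutes_inj_on atLeast0LessThan)
    show "card ((\<lambda>\<rho>. map \<rho> [0..<n]) ` {\<rho>. \<rho> permutes {..<n}}) = card (permutations_of_set {..<n})"
      using card_image[OF inj] card_permutations[of "{..<n}" n] by simp
  qed simp
qed

text \<open>
  For a fixed permutation each factor depends on a single sign only, because \<open>cross\<close> is invariant under
  inverting its last argument.  Hence the sum over all signs is a product of sums of two terms.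
\<close>
lemma hyperoctahedral_sum:
  assumes len: "length lam = n"
  shows "(\<Sum>w\<in>hyperoctahedral n.
        hyperoctahedral_act w
          (\<lambda>y. (\<Prod>i<n. u_factor a b t0 t1 t2 t3 (lam ! i) (y i)) *
                (\<Prod>i<n. \<Prod>j\<in>{i<..<n}.
                   (1 - t * inverse (y i) * y j) / (1 - inverse (y i) * y j) *
                   ((1 - t * inverse (y i) * inverse (y j)) / (1 - inverse (y i) * inverse (y j)))))
          z) = symsum lam {..<n} z" (is "(\<Sum>w\<in>_. ?T w) = _")
proof -
  define f where "f \<rho> i s = u_factor a b t0 t1 t2 t3 (lam ! i) (z (\<rho> i) powi s) *
      (\<Prod>j\<in>{i<..<n}. cross t (z (\<rho> i) powi s) (z (\<rho> j)))" for \<rho> i and s :: int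
  have T: "?T (\<rho>, \<epsilon>) = (\<Prod>i<n. f \<rho> i (\<epsilon> i))" if "\<epsilon> \<in> {..<n} \<rightarrow>\<^sub>E {1, -1}" for \<rho> \<epsilon>
  proof -
    have "cross t x (z (\<rho> j) powi \<epsilon> j) = cross t x (z (\<rho> j))" if "j < n" for j x
    proof -
      have "\<epsilon> j = 1 \<or> \<epsilon> j = -1" using \<open>\<epsilon> \<in> _\<close> that by (auto simp: PiE_def Pi_def)
      then show ?thesis by (auto simp: power_int_minus)
    qed
    then show ?thesis
      unfolding hyperoctahedral_act_def f_def prod.distrib fst_conv snd_conv cross_def[symmetric]
      by (intro arg_cong2[of _ _ _ _ "(*)"] prod.cong refl) auto
  qed
  have sumf: "(\<Sum>s\<in>{1, -1}. f \<rho> i s) = branches (lam ! i) (\<rho> i) (\<rho> ` {i<..<n}) z"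
    if "\<rho> permutes {..<n}" for \<rho> i
    using permutes_inj_on[OF that]
    by (simp add: f_def branches_def branch_def power_int_minus prod.reindex)
  have "(\<Sum>w\<in>hyperoctahedral n. ?T w)
      = (\<Sum>\<rho> | \<rho> permutes {..<n}. \<Sum>\<epsilon>\<in>{..<n} \<rightarrow>\<^sub>E {1, -1}. ?T (\<rho>, \<epsilon>))"
    by (simp add: hyperoctahedral_def sum.cartesian_product)
  also have "\<dots> = (\<Sum>\<rho> | \<rho> permutes {..<n}. \<Prod>i<n. \<Sum>s\<in>{1, -1}. f \<rho> i s)"
  proof (intro sum.cong refl)
    fix \<rho>
    have "(\<Prod>i<n. \<Sum>s\<in>{1, -1}. f \<rho> i s) = (\<Sum>\<epsilon>\<in>{..<n} \<rightarrow>\<^sub>E {1, -1}. \<Prod>i<n. f \<rho> i (\<epsilon> i))"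
      by (rule prod_sum_PiE) auto
    also have "\<dots> = (\<Sum>\<epsilon>\<in>{..<n} \<rightarrow>\<^sub>E {1, -1}. ?T (\<rho>, \<epsilon>))"
      by (intro sum.cong refl) (simp only: T)
    finally show "(\<Sum>\<epsilon>\<in>{..<n} \<rightarrow>\<^sub>E {1, -1}. ?T (\<rho>, \<epsilon>)) = (\<Prod>i<n. \<Sum>s\<in>{1, -1}. f \<rho> i s)" by simp
  qed
  also have "\<dots> = (\<Sum>\<rho> | \<rho> permutes {..<n}. \<Prod>i<n. branches (lam ! i) (\<rho> i) (\<rho> ` {i<..<n}) z)"
    by (intro sum.cong prod.cong refl sumf) simp
  also have "\<dots> = (\<Sum>\<rho> | \<rho> permutes {..<n}. \<Prod>i<length lam. branches (lam ! i) (map \<rho> [0..<n] ! i)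
        (set (drop (Suc i) (map \<rho> [0..<n]))) z)"
    by (intro sum.cong prod.cong refl)
      (auto simp: len drop_map simp flip: atLeastSucLessThan_greaterThanLessThan)
  also have "\<dots> = (\<Sum>xs\<in>permutations_of_set {..<n}. \<Prod>i<length lam. branches (lam ! i) (xs ! i)
        (set (drop (Suc i) xs)) z)"
    by (rule sum.reindex_bij_betw[OF bij_betw_permutes_lists])
  also have "\<dots> = symsum lam {..<n} z"
    by (rule symsum_permutations[symmetric]) (simp_all add: len)
  finally show ?thesis .
qed

lemma koornwinder_K_symsum:
  assumes "length lam = n"
  shows "koornwinder_K n t a b t0 t1 t2 t3 lam z = symsum lam {..<n} z / v_factor t a b t0 t1 t2 t3 lam"
  unfolding koornwinder_K_def hyperoctahedral_sum[OF assms] by simp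

section \<open>The density\<close>

text \<open>
  The density is a product of the functions \<open>half1\<close> and \<open>half2\<close> and of their images under \<open>x \<mapsto> 1/x\<close>.  The
  images cancel against \<open>branch\<close>, and the functions themselves have no poles in the unit disc.
\<close>
definition half1 :: "complex \<Rightarrow> complex" where
  "half1 x = (1 - x ^ 2) / ((1 - t0 * x) * (1 - t1 * x) * (1 - t2 * x) * (1 - t3 * x))"

definition half2 :: "complex \<Rightarrow> complex \<Rightarrow> complex" where
  "half2 x y = (1 - x * y) / (1 - t * x * y) * ((1 - x * inverse y) / (1 - t * x * inverse y))"

definition dens1 :: "complex \<Rightarrow> complex" where
  "dens1 x = half1 x * half1 (inverse x)"

definition dens2 :: "complex \<Rightarrow> complex \<Rightarrow> complex" where
  "dens2 x y = half2 x y * half2 (inverse x) y"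

text \<open>The symmetric density without the factor \<open>1 / (2\<^sup>m m!)\<close>, for an arbitrary index set.\<close>
definition density :: "nat set \<Rightarrow> (nat \<Rightarrow> complex) \<Rightarrow> complex" where
  "density A z = (\<Prod>i\<in>A. dens1 (z i)) * (\<Prod>i\<in>A. \<Prod>j\<in>{j\<in>A. i < j}. dens2 (z i) (z j))"

lemma dens2_commute: "dens2 x y = dens2 y x"
  by (simp add: dens2_def half2_def mult.commute mult.left_commute)

lemma koornwinder_density_eq:
  "koornwinder_density m t t0 t1 t2 t3 z = density {..<m} z / (2 ^ m * fact m)"
proof -
  have "(\<Prod>s\<in>{1, -1::int}.
        (1 - x powi (2 * s)) /
        ((1 - t0 * x powi s) * (1 - t1 * x powi s)
         * (1 - t2 * x powi s) * (1 - t3 * x powi s))) = dens1 x" for x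
    by (simp add: dens1_def half1_def power_int_minus power_inverse)
  moreover have "(\<Prod>s\<in>{1, -1::int}. \<Prod>s'\<in>{1, -1::int}.
        (1 - x powi s * y powi s') / (1 - t * x powi s * y powi s')) = dens2 x y" for x y
    by (simp add: dens2_def half2_def power_int_minus)
  moreover have "{j \<in> {..<m}. i < j} = {i<..<m}" for i by auto
  ultimately show ?thesis
    unfolding koornwinder_density_def density_def by simp
qed

text \<open>
  Any variable can be split off, not only one with the least index, because \<open>dens2\<close> is symmetric.
\<close>
lemma density_insert:
  assumes "finite B" "k \<notin> B"
  shows "density (insert k B) z = dens1 (z k) * (\<Prod>j\<in>B. dens2 (z k) (z j)) * density B z"
proof -
  have 1: "(\<Prod>j\<in>{j\<in>insert k B. i < j}. dens2 (z i) (z j))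
      = (if i < k then dens2 (z k) (z i) else 1) * (\<Prod>j\<in>{j\<in>B. i < j}. dens2 (z i) (z j))" if "i \<in> B" for i
  proof (cases "i < k")
    case True
    then have "{j\<in>insert k B. i < j} = insert k {j\<in>B. i < j}" by auto
    with True assms show ?thesis by (simp add: dens2_commute)
  next
    case False
    then have "{j\<in>insert k B. i < j} = {j\<in>B. i < j}" by auto
    with False show ?thesis by simp
  qed
  have "{j\<in>insert k B. k < j} = {j\<in>B. k < j}" by auto
  then have P1: "(\<Prod>j\<in>{j\<in>insert k B. k < j}. dens2 (z k) (z j)) = (\<Prod>j\<in>B. if k < j then dens2 (z k) (z j) else 1)"
    using assms by (simp add: prod.inter_filter)
  have "(if j < k then x else 1) * (if k < j then x else 1) = x" if "j \<in> B" for j and x :: complex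
    using that assms by (cases j k rule: linorder_cases) auto
  then have P2: "(\<Prod>j\<in>B. if j < k then dens2 (z k) (z j) else 1) * (\<Prod>j\<in>B. if k < j then dens2 (z k) (z j) else 1)
     = (\<Prod>j\<in>B. dens2 (z k) (z j))"
    by (simp flip: prod.distrib)
  have P3: "(\<Prod>i\<in>B. \<Prod>j\<in>{j\<in>insert k B. i < j}. dens2 (z i) (z j))
      = (\<Prod>i\<in>B. if i < k then dens2 (z k) (z i) else 1) * (\<Prod>i\<in>B. \<Prod>j\<in>{j\<in>B. i < j}. dens2 (z i) (z j))"
    unfolding prod.distrib[symmetric] by (intro prod.cong refl 1)
  show ?thesis
    unfolding density_def prod.insert[OF assms] P1 P3 P2[symmetric] by (simp only: ac_simps)
qed

lemma symsum_cong:
  assumes "\<And>i. i \<in> A \<Longrightarrow> z i = z' i"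
  shows "symsum lam A z = symsum lam A z'"
  using assms
proof (induction lam arbitrary: A)
  case (Cons l lam)
  have "symsum lam (A - {k}) z = symsum lam (A - {k}) z'" for k
    by (rule Cons.IH) (use Cons.prems in auto)
  moreover have "branch l x (A - {k}) z = branch l x (A - {k}) z'" for x k
    using Cons.prems by (auto simp: branch_def intro!: prod.cong)
  ultimately show ?case using Cons.prems by (auto intro!: sum.cong)
qed simp

lemma density_cong:
  assumes "\<And>i. i \<in> A \<Longrightarrow> z i = z' i"
  shows "density A z = density A z'"
  using assms by (auto simp: density_def intro!: arg_cong2[of _ _ _ _ "(*)"] prod.cong)

text \<open>Inverting variables only permutes the two terms of each \<open>branches\<close>.\<close>
lemma symsum_inverse:
  assumes "\<And>i. i \<in> A \<Longrightarrow> z' i = z i \<or> z' i = inverse (z i)"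
  shows "symsum lam A z' = symsum lam A z"
  using assms
proof (induction lam arbitrary: A)
  case (Cons l lam)
  have 1: "symsum lam (A - {k}) z' = symsum lam (A - {k}) z" for k
    by (rule Cons.IH) (use Cons.prems in auto)
  have 2: "branch l x (A - {k}) z' = branch l x (A - {k}) z" for x k
    using Cons.prems unfolding branch_def
    by (intro arg_cong2[of _ _ _ _ "(*)"] prod.cong refl) (metis DiffD1 cross_inverse)
  have "branches l k (A - {k}) z' = branches l k (A - {k}) z" if "k \<in> A" for k
    using Cons.prems[OF that] unfolding branches_def 2 by (auto simp: add.commute)
  then show ?case unfolding symsum_Cons by (simp add: 1)
qed simp

lemma dens1_inverse [simp]: "dens1 (inverse x) = dens1 x"
  by (simp add: dens1_def)

lemma dens2_inverse [simp]: "dens2 (inverse x) y = dens2 x y"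
  by (simp add: dens2_def)

end

section \<open>Holomorphic continuation in the variable of the largest part\<close>

lemma one_minus_nonzero: "norm w < 1 \<Longrightarrow> 1 - w \<noteq> (0::complex)"
  by auto

lemma norm_mult_less_one_torus: "norm (t * x * y) < 1" if "norm t < 1" "norm x \<le> 1" "norm y = 1" for t x y :: complex
proof -
  have "norm (t * x * y) = norm t * norm x" using that by (simp add: norm_mult)
  also have "\<dots> \<le> norm t" using that by (simp add: mult_left_le)
  finally show ?thesis using that by simp
qed

context koornwinder
begin

text \<open>The points \<open>x\<close> of the circle at which a further variable with value \<open>x\<close> creates no pole.\<close>
definition off_poles :: "nat set \<Rightarrow> (nat \<Rightarrow> complex) \<Rightarrow> complex \<Rightarrow> bool" where
  "off_poles B z x \<longleftrightarrow> norm x = 1 \<and> x ^ 2 \<noteq> 1 \<and> (\<forall>j\<in>B. x \<noteq> z j \<and> x * z j \<noteq> 1)"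

text \<open>
  The coefficient with which \<open>x\<close> receives the part \<open>l\<close>, times the part of the density that contains \<open>x\<close>
  (see \<open>branch_densities\<close>).
\<close>
definition peel_weight :: "nat \<Rightarrow> nat set \<Rightarrow> (nat \<Rightarrow> complex) \<Rightarrow> complex \<Rightarrow> complex" where
  "peel_weight l B z x = x ^ l * half1 x * (\<Prod>j\<in>B. half2 x (z j))"

text \<open>
  The constant that integrating out a variable with part \<open>l\<close> produces.  In \<open>m # mu\<close> with \<open>m = l\<close>, the
  variable either receives the first part, with a sign: the negative sign contributes \<open>1\<close>, and the positive
  sign contributes only for \<open>l = 1\<close>.  Or it receives a later part, and each part passed on the way gives a
  factor \<open>t\<close>.
\<close>
fun peel_factor :: "nat \<Rightarrow> nat list \<Rightarrow> complex" where
  "peel_factor l [] = 0"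
| "peel_factor l (m # mu) = (if m = l
     then 1 - (if l = 1 then t0 * t1 * t2 * t3 * t ^ (2 * length mu) else 0) + t * peel_factor l mu
     else 0)"

definition den :: "complex \<Rightarrow> complex" where
  "den x = (1 - t0 * x) * (1 - t1 * x) * (1 - t2 * x) * (1 - t3 * x)"

definition num :: "complex \<Rightarrow> complex" where
  "num x = (x - t0) * (x - t1) * (x - t2) * (x - t3)"

lemma den_nonzero: "norm x \<le> 1 \<Longrightarrow> den x \<noteq> 0"
  using norm_mult_less_one_torus[of t0 x 1] norm_mult_less_one_torus[of t1 x 1]
    norm_mult_less_one_torus[of t2 x 1] norm_mult_less_one_torus[of t3 x 1]
    norm_t0 norm_t1 norm_t2 norm_t3
  by (simp add: den_def) (metis norm_one less_irrefl)

lemma mult_torus_neq_one: "norm x \<le> 1 \<Longrightarrow> norm y = 1 \<Longrightarrow> t * x * y \<noteq> 1"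
  using norm_mult_less_one_torus[OF norm_t, of x y] by auto

lemma half2_inverse_right: "half2 x (inverse y) = half2 x y"
  by (simp add: half2_def mult.commute)

lemma cross_mult_half2_inverse:
  assumes "norm x = 1" "norm y = 1" "x \<noteq> y" "x * y \<noteq> 1"
  shows "cross t x y * half2 (inverse x) y = 1"
proof -
  have [simp]: "x \<noteq> 0" "y \<noteq> 0" using assms by auto
  have "1 - t * inverse x * y \<noteq> 0" "1 - t * inverse x * inverse y \<noteq> 0"
    using assms mult_torus_neq_one[of "inverse x" y] mult_torus_neq_one[of "inverse x" "inverse y"]
    by (simp_all add: norm_inverse)
  moreover have "1 - inverse x * y \<noteq> 0" "1 - inverse x * inverse y \<noteq> 0"
    using assms by (auto simp: field_simps)
  ultimately show ?thesis by (simp add: cross_def half2_def)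
qed

lemma cross_inverse_mult_half2:
  assumes "norm x = 1" "norm y = 1" "x \<noteq> y" "x * y \<noteq> 1"
  shows "cross t (inverse x) y * half2 x y = 1"
proof -
  have [simp]: "x \<noteq> 0" "y \<noteq> 0" using assms by auto
  have "inverse x \<noteq> y" "inverse x * y \<noteq> 1" using assms by (auto simp: field_simps)
  then show ?thesis
    using cross_mult_half2_inverse[of "inverse x" y] assms by (simp add: norm_inverse)
qed

lemma cross_mult_half2:
  assumes "norm x = 1" "norm y = 1" "x \<noteq> y" "x * y \<noteq> 1"
  shows "cross t x y * half2 x y =
    (x - t * y) * (x - t * inverse y) / ((1 - t * x * y) * (1 - t * x * inverse y))"
proof -
  have [simp]: "x \<noteq> 0" "y \<noteq> 0" using assms by auto
  have nz: "1 - x * y \<noteq> 0" "1 - x * inverse y \<noteq> 0"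
    using assms by (auto simp: field_simps)
  have 1: "(1 - t * inverse x * y) * (1 - t * inverse x * inverse y)
      = (x - t * y) * (x - t * inverse y) * inverse (x ^ 2)"
    by (simp add: power2_eq_square field_simps)
  have 2: "(1 - inverse x * y) * (1 - inverse x * inverse y) = (1 - x * y) * (1 - x * inverse y) * inverse (x ^ 2)"
    by (simp add: power2_eq_square field_simps)
  show ?thesis unfolding cross_def half2_def times_divide_times_eq 1 2 using nz by simp
qed

text \<open>
  A pole that \<open>x\<close> has because another variable \<open>y\<close> comes before it is cancelled by \<open>half2\<close>; the value at
  \<open>x = 0\<close> is \<open>t\<close>.
\<close>
lemma half2_mult_cross:
  assumes "norm x = 1" "norm y = 1" "x \<noteq> y" "x * y \<noteq> 1"
  shows "half2 x y * cross t y x = (t - x * y) / (1 - t * x * y)"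
proof -
  have [simp]: "x \<noteq> 0" "y \<noteq> 0" using assms by auto
  have nz: "1 - x * y \<noteq> 0" "1 - x * inverse y \<noteq> 0"
    using assms by (auto simp: field_simps)
  have nz2: "1 - t * x * inverse y \<noteq> 0"
    using assms mult_torus_neq_one[of x "inverse y"] by (simp add: norm_inverse)
  have c: "cross t y x = (1 - t * x * inverse y) / (1 - x * inverse y) * ((t - x * y) / (1 - x * y))"
  proof -
    have "(1 - t * inverse y * inverse x) / (1 - inverse y * inverse x) = (x * y - t) / (x * y - 1)"
      using nz by (simp add: field_simps)
    also have "\<dots> = (t - x * y) / (1 - x * y)" by (subst minus_divide_divide[symmetric]) simp
    finally show ?thesis unfolding cross_def by (simp only: ac_simps)
  qed
  show ?thesis unfolding half2_def c using nz nz2 by simp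
qed

text \<open>
  \<open>ext_pos\<close> and \<open>ext_neg\<close> are the functions \<open>x\<^sup>l half1(x) u\<^sub>m(x)\<close> and \<open>x\<^sup>l half1(x) u\<^sub>m(1/x)\<close> with the zeros of
  \<open>1 - x\<^sup>2\<close> cancelled.  For \<open>m \<le> l\<close> and \<open>l > 0\<close> they are holomorphic in the disc.  At \<open>0\<close> the first
  vanishes unless \<open>l = m = 1\<close>, the second unless \<open>l = m\<close>.
\<close>
definition ext_pos :: "nat \<Rightarrow> nat \<Rightarrow> complex \<Rightarrow> complex" where
  "ext_pos l m x = (if m = 0 then - (x ^ l * (x - a) * (x - b)) / den x
     else - (x ^ (l + m - 2) * num x) / den x)"

definition ext_neg :: "nat \<Rightarrow> nat \<Rightarrow> complex \<Rightarrow> complex" where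
  "ext_neg l m x = (if m = 0 then x ^ l * (1 - a * x) * (1 - b * x) / den x else x ^ (l - m))"

lemma half1_den: "half1 x = (1 - x ^ 2) / den x"
  by (simp add: half1_def den_def)

lemma peel_weight_u_inverse:
  assumes "norm x = 1" "x ^ 2 \<noteq> 1" "m \<le> l"
  shows "x ^ l * half1 x * u_factor a b t0 t1 t2 t3 m (inverse x) = ext_neg l m x"
proof -
  define c where "c = 1 - x ^ 2"
  have x: "x \<noteq> 0" "c \<noteq> 0" "den x \<noteq> 0" using assms den_nonzero by (auto simp: c_def)
  show ?thesis
  proof (cases "m = 0")
    case True
    then show ?thesis using x
      by (simp add: half1_den u_factor_def ext_neg_def flip: c_def)
  next
    case False
    then have u: "u_factor a b t0 t1 t2 t3 m (inverse x) = den x / (c * x ^ m)"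
      using x by (simp add: u_factor_def den_def power_inverse divide_inverse flip: c_def)
    have "x ^ l = x ^ (l - m) * x ^ m" using assms(3) by (simp flip: power_add)
    then show ?thesis using x False
      by (simp add: half1_den ext_neg_def u flip: c_def)
  qed
qed

lemma peel_weight_u:
  assumes "norm x = 1" "x ^ 2 \<noteq> 1" "l > 0"
  shows "x ^ l * half1 x * u_factor a b t0 t1 t2 t3 m x = ext_pos l m x"
proof -
  define c where "c = 1 - x ^ 2"
  have x: "x \<noteq> 0" "c \<noteq> 0" "den x \<noteq> 0" using assms den_nonzero by (auto simp: c_def)
  have inv: "1 - d * inverse x = (x - d) * inverse x" for d using x by (simp add: algebra_simps)
  have sq: "1 - inverse x ^ 2 = - c * inverse x ^ 2"
    using x by (simp add: c_def power2_eq_square field_simps)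
  show ?thesis
  proof (cases "m = 0")
    case True
    have "u_factor a b t0 t1 t2 t3 m x = - ((x - a) * (x - b)) / c"
      using True x unfolding u_factor_def sq inv by (simp add: power2_eq_square divide_simps)
    then show ?thesis using x True by (simp add: half1_den ext_pos_def mult.assoc flip: c_def)
  next
    case False
    have "u_factor a b t0 t1 t2 t3 m x = - (x ^ m * num x * inverse x ^ 2) / c"
      using x False unfolding u_factor_def sq inv by (simp add: num_def power2_eq_square divide_simps)
    moreover have "x ^ l * (x ^ m * inverse x ^ 2) = x ^ (l + m - 2)"
      using x False assms(3) by (simp add: power_diff power_add divide_inverse power_inverse)
    then have "x ^ l * (x ^ m * num x * inverse x ^ 2) = x ^ (l + m - 2) * num x"
      by (metis mult.assoc mult.commute)
    ultimately show ?thesis using x False by (simp add: half1_den ext_pos_def flip: c_def)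
  qed
qed

lemma peel_factor_notin: "l \<notin> set mu \<Longrightarrow> peel_factor l mu = 0"
  by (cases mu) auto

lemma off_polesD: assumes "off_poles B z x" "j \<in> B" shows "norm x = 1" "x \<noteq> z j" "x * z j \<noteq> 1"
  using assms by (auto simp: off_poles_def)

lemma peel_weight_branch_inverse:
  assumes "off_poles B z x" "\<And>j. j \<in> B \<Longrightarrow> norm (z j) = 1" "m \<le> l"
  shows "peel_weight l B z x * branch m (inverse x) B z = ext_neg l m x"
proof -
  have *: "(\<Prod>j\<in>B. half2 x (z j)) * (\<Prod>j\<in>B. cross t (inverse x) (z j)) = 1"
    unfolding prod.distrib[symmetric] using cross_inverse_mult_half2 off_polesD[OF assms(1)] assms(2)
    by (intro prod.neutral ballI) (subst mult.commute, blast)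
  have "peel_weight l B z x * branch m (inverse x) B z = (x ^ l * half1 x * u_factor a b t0 t1 t2 t3 m (inverse x)) *
      ((\<Prod>j\<in>B. half2 x (z j)) * (\<Prod>j\<in>B. cross t (inverse x) (z j)))"
    unfolding peel_weight_def branch_def by (simp only: ac_simps)
  then show ?thesis unfolding * using peel_weight_u_inverse assms by (simp add: off_poles_def)
qed

lemma peel_weight_branch:
  assumes "off_poles B z x" "\<And>j. j \<in> B \<Longrightarrow> norm (z j) = 1" "l > 0"
  shows "peel_weight l B z x * branch m x B z = ext_pos l m x *
    (\<Prod>j\<in>B. (x - t * z j) * (x - t * inverse (z j)) / ((1 - t * x * z j) * (1 - t * x * inverse (z j))))"
proof -
  have *: "(\<Prod>j\<in>B. half2 x (z j)) * (\<Prod>j\<in>B. cross t x (z j)) =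
    (\<Prod>j\<in>B. (x - t * z j) * (x - t * inverse (z j)) / ((1 - t * x * z j) * (1 - t * x * inverse (z j))))"
    unfolding prod.distrib[symmetric] using cross_mult_half2 off_polesD[OF assms(1)] assms(2)
    by (intro prod.cong refl) (subst mult.commute, blast)
  have "peel_weight l B z x * branch m x B z = (x ^ l * half1 x * u_factor a b t0 t1 t2 t3 m x) *
      ((\<Prod>j\<in>B. half2 x (z j)) * (\<Prod>j\<in>B. cross t x (z j)))"
    unfolding peel_weight_def branch_def by (simp only: ac_simps)
  then show ?thesis unfolding * using peel_weight_u assms by (simp add: off_poles_def)
qed

text \<open>
  By induction on \<open>mu\<close> for all \<open>B\<close>, following the recursion of \<open>symsum\<close>.  If the new variable receives the first
  part, the product is explicit.  If a variable \<open>z\<^sub>i\<close> does, then \<open>half2_mult_cross\<close> moves its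
  interaction with \<open>x\<close> into a holomorphic factor and leaves the same problem for \<open>B - {i}\<close>.  At \<open>0\<close> the terms
  of the second kind add up to \<open>t\<close> times a symmetrised sum over \<open>B\<close>.

  The equality is only claimed off a finite set, since \<open>symsum\<close> is evaluated with the convention \<open>1/0 = 0\<close>.  The
  \<open>z\<^sub>j\<close> themselves may coincide: they only enter through coefficients that are the same on both sides.
\<close>
lemma peel_weight_symsum_extends:
  assumes "l > 0" "sorted_wrt (\<ge>) mu" "\<And>m. m \<in> set mu \<Longrightarrow> m \<le> l"
    and "finite B" "k \<notin> B" "length mu = Suc (card B)" "\<And>j. j \<in> B \<Longrightarrow> norm (z j) = 1"
  shows "\<exists>H. H holomorphic_on cball 0 1 \<and> H 0 = peel_factor l mu * symsum (tl mu) B z \<and>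
    (\<forall>x. off_poles B z x \<longrightarrow> peel_weight l B z x * symsum mu (insert k B) (z(k := x)) = H x)"
  using assms
proof (induction mu arbitrary: B)
  case (Cons m mu)
  define G where "G x = (\<Prod>j\<in>B. (x - t * z j) * (x - t * inverse (z j)) /
      ((1 - t * x * z j) * (1 - t * x * inverse (z j))))" for x
  define H1 where "H1 x = ext_neg l m x + ext_pos l m x * G x" for x
  have ml: "m \<le> l" using Cons.prems by simp
  have nz: "t * x * z j \<noteq> 1" "t * x * inverse (z j) \<noteq> 1" if "j \<in> B" "norm x \<le> 1" for j x
    using that Cons.prems(7) mult_torus_neq_one by (simp_all add: norm_inverse)
  have H1_hol: "H1 holomorphic_on cball 0 1"
  proof -
    have den: "den holomorphic_on cball 0 1" and num: "num holomorphic_on cball 0 1"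
      unfolding den_def num_def by (auto intro!: holomorphic_intros)
    have "G holomorphic_on cball 0 1"
      unfolding G_def by (intro holomorphic_intros) (auto simp: nz)
    moreover have "ext_neg l m holomorphic_on cball 0 1"
      unfolding ext_neg_def using den by (cases "m = 0") (auto intro!: holomorphic_intros simp: den_nonzero)
    moreover have "ext_pos l m holomorphic_on cball 0 1"
      unfolding ext_pos_def using den num by (cases "m = 0") (auto intro!: holomorphic_intros simp: den_nonzero)
    ultimately show ?thesis unfolding H1_def by (intro holomorphic_intros)
  qed
  have "\<exists>Hi. \<forall>i\<in>B. Hi i holomorphic_on cball 0 1 \<and> Hi i 0 = peel_factor l mu * symsum (tl mu) (B - {i}) z \<and>
    (\<forall>x. off_poles (B - {i}) z x \<longrightarrow> peel_weight l (B - {i}) z x * symsum mu (insert k (B - {i})) (z(k := x)) = Hi i x)"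
  proof (intro bchoice ballI Cons.IH)
    fix i assume "i \<in> B"
    then show "length mu = Suc (card (B - {i}))"
      using Cons.prems(4,6) card_Suc_Diff1[of B i] by simp
  qed (use Cons.prems in auto)
  then obtain Hi where Hi: "\<And>i. i \<in> B \<Longrightarrow> Hi i holomorphic_on cball 0 1"
    "\<And>i. i \<in> B \<Longrightarrow> Hi i 0 = peel_factor l mu * symsum (tl mu) (B - {i}) z"
    "\<And>i x. i \<in> B \<Longrightarrow> off_poles (B - {i}) z x \<Longrightarrow>
       peel_weight l (B - {i}) z x * symsum mu (insert k (B - {i})) (z(k := x)) = Hi i x"
    by blast
  define c where "c i x = branch m (z i) (B - {i}) z * ((t - x * z i) / (1 - t * x * z i)) +
     branch m (inverse (z i)) (B - {i}) z * ((t - x * inverse (z i)) / (1 - t * x * inverse (z i)))" for i x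
  define H where "H x = H1 x * symsum mu B z + (\<Sum>i\<in>B. c i x * Hi i x)" for x
  have "H holomorphic_on cball 0 1"
    unfolding H_def c_def by (intro holomorphic_intros H1_hol Hi) (auto simp: nz)
  moreover have "H 0 = peel_factor l (m # mu) * symsum (tl (m # mu)) B z"
  proof -
    \<comment> \<open>Each \<open>z\<^sub>j\<close> contributes \<open>(- t z\<^sub>j) (- t / z\<^sub>j) = t\<^sup>2\<close> to \<open>G 0\<close>, and \<open>mu\<close> has as many entries as \<open>B\<close>.\<close>
    have H1_0: "H1 0 = (if m = l then 1 - (if l = 1 then t0 * t1 * t2 * t3 * t ^ (2 * length mu) else 0) else 0)"
    proof -
      have "G 0 = (\<Prod>j\<in>B. t ^ 2)"
        unfolding G_def using Cons.prems(7)
      proof (intro prod.cong refl)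
        fix j assume "j \<in> B"
        then have "z j \<noteq> 0" using Cons.prems(7)[of j] by auto
        then show "(0 - t * z j) * (0 - t * inverse (z j)) /
          ((1 - t * 0 * z j) * (1 - t * 0 * inverse (z j))) = t ^ 2"
          by (simp add: power2_eq_square)
      qed
      then have "G 0 = t ^ (2 * length mu)"
        using Cons.prems(6) by (simp add: power_mult)
      then show ?thesis
        using ml Cons.prems(1) by (auto simp: H1_def ext_neg_def ext_pos_def den_def num_def power_0_left)
    qed
    have c0: "c i 0 = t * branches m i (B - {i}) z" for i
      by (simp add: c_def branches_def algebra_simps)
    have "(\<Sum>i\<in>B. c i 0 * Hi i 0) = t * peel_factor l mu * (\<Sum>i\<in>B. branches m i (B - {i}) z * symsum (tl mu) (B - {i}) z)"
      by (simp add: c0 Hi(2) sum_distrib_left mult.assoc mult.left_commute)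
    also have "\<dots> = (if m = l then t * peel_factor l mu * symsum mu B z else 0)"
    proof (cases "m = l")
      case False
      then have "l \<notin> set mu" using Cons.prems(2) ml by auto
      then show ?thesis by (simp add: peel_factor_notin False)
    next
      case True
      then show ?thesis
      proof (cases mu)
        \<comment> \<open>For \<open>m' = l\<close> the sum is the recursion for \<open>symsum mu B\<close>; otherwise \<open>peel_factor l mu = 0\<close>.\<close>
        case (Cons m' mu')
        show ?thesis
        proof (cases "m' = l")
          case True
          with \<open>m = l\<close> Cons show ?thesis by (simp add: symsum_Cons del: symsum.simps)
        qed (use Cons \<open>m = l\<close> in simp)
      qed simp
    qed
    finally show ?thesis by (simp add: H_def H1_0 algebra_simps)
  qed
  moreover have "peel_weight l B z x * symsum (m # mu) (insert k B) (z(k := x)) = H x" if x: "off_poles B z x" for x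
  proof -
    let ?z = "z(k := x)"
    have nx: "norm x = 1" using x by (simp add: off_poles_def)
    have cong: "symsum mu B ?z = symsum mu B z"
      using Cons.prems(5) by (intro symsum_cong) auto
    have brc: "branch m y B' ?z = branch m y B' z" if "k \<notin> B'" for y B'
      unfolding branch_def using that by (intro arg_cong2[of _ _ _ _ "(*)"] prod.cong) auto
    have br: "branches m k B ?z = branch m x B z + branch m (inverse x) B z"
      using Cons.prems(5) by (simp add: branches_def brc)
    have "peel_weight l B z x * branches m k B ?z = H1 x"
      using peel_weight_branch_inverse[OF x Cons.prems(7) ml] peel_weight_branch[OF x Cons.prems(7,1)]
      by (simp add: br distrib_left H1_def G_def)
    moreover have "peel_weight l B z x * (branches m i (insert k B - {i}) ?z * symsum mu (insert k B - {i}) ?z) = c i x * Hi i x"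
      if i: "i \<in> B" for i
    proof -
      have ki: "k \<noteq> i" "k \<notin> B - {i}" using i Cons.prems(5) by auto
      then have ins: "insert k B - {i} = insert k (B - {i})" by auto
      have zi: "norm (z i) = 1" "x \<noteq> z i" "x * z i \<noteq> 1" using off_polesD[OF x i] Cons.prems(7) i by auto
      then have zi': "norm (inverse (z i)) = 1" "x \<noteq> inverse (z i)" "x * inverse (z i) \<noteq> 1"
      proof -
        have "z i \<noteq> 0" using zi(1) by auto
        then show "norm (inverse (z i)) = 1" "x \<noteq> inverse (z i)" "x * inverse (z i) \<noteq> 1"
          using zi by (auto simp: norm_inverse divide_inverse[symmetric])
      qed
      have "branch m y (insert k (B - {i})) ?z = branch m y (B - {i}) z * cross t y x" for y
      proof -
        have "branch m y (insert k (B - {i})) ?z = branch m y (B - {i}) ?z * cross t y x"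
          using ki Cons.prems(4) by (simp add: branch_def)
        then show ?thesis by (simp only: brc[OF ki(2)])
      qed
      then have b: "branches m i (insert k (B - {i})) ?z = branch m (z i) (B - {i}) z * cross t (z i) x
         + branch m (inverse (z i)) (B - {i}) z * cross t (inverse (z i)) x"
        using ki by (simp add: branches_def)
      have ch: "half2 x (z i) * branches m i (insert k (B - {i})) ?z = c i x"
        using half2_mult_cross[OF nx zi] half2_mult_cross[OF nx zi']
        unfolding b c_def half2_inverse_right distrib_left mult.left_commute[of "half2 x (z i)"] by simp
      have w: "peel_weight l B z x = peel_weight l (B - {i}) z x * half2 x (z i)"
        unfolding peel_weight_def using i Cons.prems(4) by (simp add: prod.remove mult.assoc mult.left_commute)
      have "peel_weight l B z x * (branches m i (insert k B - {i}) ?z * symsum mu (insert k B - {i}) ?z)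
          = (half2 x (z i) * branches m i (insert k (B - {i})) ?z) *
            (peel_weight l (B - {i}) z x * symsum mu (insert k (B - {i})) ?z)"
        unfolding ins w by (simp only: ac_simps)
      also have "\<dots> = c i x * Hi i x"
        unfolding ch using Hi(3)[OF i, of x] x by (simp add: off_poles_def)
      finally show ?thesis .
    qed
    then have "peel_weight l B z x * (\<Sum>i\<in>B. branches m i (insert k B - {i}) ?z * symsum mu (insert k B - {i}) ?z)
        = (\<Sum>i\<in>B. c i x * Hi i x)"
      unfolding sum_distrib_left by (intro sum.cong refl)
    moreover have "symsum (m # mu) (insert k B) ?z = branches m k B ?z * symsum mu B z
      + (\<Sum>i\<in>B. branches m i (insert k B - {i}) ?z * symsum mu (insert k B - {i}) ?z)"
      unfolding symsum_Cons using Cons.prems(4,5) cong by (simp add: insert_Diff_if)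
    ultimately show ?thesis by (simp only: H_def distrib_left mult.assoc[symmetric])
  qed
  ultimately show ?case by blast
qed simp

end

section \<open>Integration over the circle and the torus\<close>

lemma uniform_circle_density:
  "uniform_measure lborel {0..2 * pi} = density lborel (\<lambda>x. ennreal (indicator {0..2 * pi} x / (2 * pi)))"
  unfolding uniform_measure_def
  by (intro arg_cong2[of _ _ _ _ density] refl ext) (auto simp: indicator_def divide_ennreal_def inverse_ennreal inverse_eq_divide)

lemma sets_circle [measurable_cong, simp]: "sets circle_measure = sets borel"
  by (simp add: circle_measure_def)

lemma space_circle [simp]: "space circle_measure = UNIV"
  by (simp add: circle_measure_def)

lemma cis_measurable [measurable]: "cis \<in> borel_measurable borel"
  by (intro borel_measurable_continuous_onI continuous_intros)

lemma prob_space_circle: "prob_space circle_measure"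
  unfolding circle_measure_def
  by (intro prob_space.prob_space_distr prob_space_uniform_measure) auto

lemma AE_circle_norm: "AE x in circle_measure. norm x = 1"
  unfolding circle_measure_def by (subst AE_distr_iff) auto

lemma circle_integral_eq:
  fixes F :: "complex \<Rightarrow> complex"
  assumes [measurable]: "F \<in> borel_measurable borel"
  shows "integral\<^sup>L circle_measure F = (LINT \<theta>|lborel. (indicator {0..2 * pi} \<theta> / (2 * pi)) *\<^sub>R F (cis \<theta>))"
proof -
  have "integral\<^sup>L circle_measure F = (LINT \<theta>|uniform_measure lborel {0..2 * pi}. F (cis \<theta>))"
    unfolding circle_measure_def by (rule integral_distr) auto
  also have "\<dots> = (LINT \<theta>|lborel. (indicator {0..2 * pi} \<theta> / (2 * pi)) *\<^sub>R F (cis \<theta>))"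
    unfolding uniform_circle_density by (rule integral_density) auto
  finally show ?thesis .
qed

text \<open>Substitution of \<open>2\<pi> - \<theta>\<close> for the angle \<open>\<theta>\<close>.\<close>
lemma circle_integral_inverse:
  fixes F :: "complex \<Rightarrow> complex"
  assumes [measurable]: "F \<in> borel_measurable borel"
  shows "(LINT x|circle_measure. F (inverse x)) = integral\<^sup>L circle_measure F"
proof -
  have "integral\<^sup>L circle_measure F = (LINT \<theta>|lborel. (indicator {0..2 * pi} \<theta> / (2 * pi)) *\<^sub>R F (cis \<theta>))"
    by (rule circle_integral_eq) simp
  also have "\<dots> = \<bar>-1\<bar> *\<^sub>R (LINT \<theta>|lborel. (indicator {0..2 * pi} (2 * pi + (-1) * \<theta>) / (2 * pi)) *\<^sub>R F (cis (2 * pi + (-1) * \<theta>)))"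
    by (rule lborel_integral_real_affine) simp
  also have "\<dots> = (LINT \<theta>|lborel. (indicator {0..2 * pi} \<theta> / (2 * pi)) *\<^sub>R F (inverse (cis \<theta>)))"
  proof -
    have "indicator {0..2 * pi} (2 * pi + (-1) * \<theta>) = (indicator {0..2 * pi} \<theta> :: real)" for \<theta>
      by (auto simp: indicator_def)
    moreover have "cis (2 * pi + (-1) * \<theta>) = inverse (cis \<theta>)" for \<theta>
      using cis_mult[of "2 * pi" "- \<theta>"] by (simp add: cis_inverse)
    ultimately show ?thesis by simp
  qed
  also have "\<dots> = (LINT x|circle_measure. F (inverse x))"
    by (rule circle_integral_eq[symmetric]) simp
  finally show ?thesis ..
qed

text \<open>Up to the endpoint \<open>2\<pi>\<close>, an angle is determined by its point on the circle.\<close>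
lemma AE_cis_notin_finite:
  assumes "finite Z"
  shows "AE \<theta> in lborel. \<theta> \<in> {0..2 * pi} \<longrightarrow> cis \<theta> \<notin> Z"
proof -
  have "{\<theta> \<in> {0..2 * pi}. cis \<theta> \<in> Z} \<subseteq> insert (2 * pi) (Arg2pi ` Z)"
  proof
    fix \<theta> assume *: "\<theta> \<in> {\<theta> \<in> {0..2 * pi}. cis \<theta> \<in> Z}"
    show "\<theta> \<in> insert (2 * pi) (Arg2pi ` Z)"
    proof (cases "\<theta> = 2 * pi")
      case False
      then have "Arg2pi (cis \<theta>) = \<theta>"
        using * by (intro Arg2pi_unique[of 1]) (auto simp: cis_conv_exp)
      with * show ?thesis by (metis (mono_tags, lifting) imageI insertI2 mem_Collect_eq)
    qed simp
  qed
  then have "finite {\<theta> \<in> {0..2 * pi}. cis \<theta> \<in> Z}"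
    using assms finite_subset by blast
  then have "{\<theta> \<in> {0..2 * pi}. cis \<theta> \<in> Z} \<in> null_sets lborel"
    by (rule finite_imp_null_set_lborel)
  from AE_not_in[OF this] show ?thesis by eventually_elim auto
qed

text \<open>
  Cauchy's integral formula at the centre, for an integrand \<open>F\<close> that equals the holomorphic function only almost
  everywhere; \<open>H\<close> need not be measurable outside the disc.
\<close>
lemma circle_mean_value:
  fixes F H :: "complex \<Rightarrow> complex"
  assumes F [measurable]: "F \<in> borel_measurable borel" and H: "H holomorphic_on cball 0 1"
    and Z: "finite Z" and eq: "\<And>x. norm x = 1 \<Longrightarrow> x \<notin> Z \<Longrightarrow> F x = H x"
  shows "integral\<^sup>L circle_measure F = H 0"
proof -
  have cont: "continuous_on {0..2 * pi} (\<lambda>\<theta>. H (cis \<theta>))"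
    by (rule continuous_on_compose2[OF holomorphic_on_imp_continuous_on[OF H]]) (auto intro!: continuous_intros)
  have int: "integrable lborel (\<lambda>\<theta>. indicator {0..2 * pi} \<theta> *\<^sub>R H (cis \<theta>))"
    by (rule borel_integrable_compact[OF compact_Icc cont])
  have "integral\<^sup>L circle_measure F = (LINT \<theta>|lborel. (indicator {0..2 * pi} \<theta> / (2 * pi)) *\<^sub>R F (cis \<theta>))"
    by (rule circle_integral_eq) fact
  also have "\<dots> = (LINT \<theta>|lborel. (1 / (2 * pi)) *\<^sub>R (indicator {0..2 * pi} \<theta> *\<^sub>R H (cis \<theta>)))"
  proof (rule integral_cong_AE)
    show "(\<lambda>\<theta>. (1 / (2 * pi)) *\<^sub>R (indicator {0..2 * pi} \<theta> *\<^sub>R H (cis \<theta>))) \<in> borel_measurable lborel"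
      using int by (intro borel_measurable_scaleR borel_measurable_const borel_measurable_integrable)
    show "AE \<theta> in lborel. (indicator {0..2 * pi} \<theta> / (2 * pi)) *\<^sub>R F (cis \<theta>)
        = (1 / (2 * pi)) *\<^sub>R (indicator {0..2 * pi} \<theta> *\<^sub>R H (cis \<theta>))"
      using AE_cis_notin_finite[OF Z] by eventually_elim (auto simp: eq indicator_def)
  qed simp
  also have "\<dots> = (1 / (2 * pi)) *\<^sub>R (LINT \<theta>:{0..2 * pi}|lborel. H (cis \<theta>))"
    by (simp add: set_lebesgue_integral_def flip: integral_scaleR_right)
  also have "(LINT \<theta>:{0..2 * pi}|lborel. H (cis \<theta>)) = integral {0..2 * pi} (\<lambda>\<theta>. H (cis \<theta>))"
    by (rule set_borel_integral_eq_integral) (use int in \<open>simp add: set_integrable_def\<close>)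
  also have "\<dots> = 2 * pi * H 0"
  proof -
    have "((\<lambda>u. H u / (u - 0)) has_contour_integral (2 * of_real pi * \<i> * H 0)) (circlepath 0 1)"
      by (rule Cauchy_integral_circlepath)
        (use H in \<open>auto intro: holomorphic_on_imp_continuous_on holomorphic_on_subset\<close>)
    then have "((\<lambda>\<theta>. H (cis \<theta>) / cis \<theta> * \<i> * cis \<theta>) has_integral (2 * of_real pi * \<i> * H 0)) {0..2 * pi}"
      unfolding circlepath_def by (subst (asm) has_contour_integral_part_circlepath_iff) auto
    then have "((\<lambda>\<theta>. - \<i> * (H (cis \<theta>) / cis \<theta> * \<i> * cis \<theta>)) has_integral (- \<i> * (2 * of_real pi * \<i> * H 0))) {0..2 * pi}"
      by (rule has_integral_mult_right)
    then have "((\<lambda>\<theta>. H (cis \<theta>)) has_integral (2 * pi * H 0)) {0..2 * pi}"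
      by (simp add: field_simps)
    then show ?thesis by (rule integral_unique)
  qed
  finally show ?thesis by (simp add: scaleR_conv_of_real)
qed

lemma AE_circle_notin:
  assumes "finite Z" shows "AE x in circle_measure. x \<notin> Z"
proof -
  have "closed Z" using assms by (rule finite_imp_closed)
  then have "{x \<in> space borel. x \<notin> Z} \<in> sets borel"
    by (simp add: Collect_neg_eq)
  then show ?thesis
    unfolding circle_measure_def
    by (subst AE_distr_iff) (use AE_cis_notin_finite[OF assms] in \<open>auto simp: AE_uniform_measure\<close>)
qed

text \<open>The sum over both signs of a variable, with only one of the two terms holomorphic.\<close>
lemma circle_symmetrised_mean_value:
  fixes F H :: "complex \<Rightarrow> complex"
  assumes F [measurable]: "F \<in> borel_measurable borel" and H: "H holomorphic_on cball 0 1"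
    and Z: "finite Z" and eq: "\<And>x. norm x = 1 \<Longrightarrow> x \<notin> Z \<Longrightarrow> F x = H x"
  shows "(LINT x|circle_measure. F x + F (inverse x)) = 2 * H 0"
proof -
  interpret prob_space circle_measure by (rule prob_space_circle)
  have "compact (H ` cball 0 1)"
    using H by (intro compact_continuous_image holomorphic_on_imp_continuous_on) auto
  then have "bounded (H ` cball 0 1)" by (rule compact_imp_bounded)
  then obtain M where "\<forall>y\<in>H ` cball 0 1. norm y \<le> M" unfolding bounded_iff by blast
  then have M: "norm (H x) \<le> M" if "norm x \<le> 1" for x using that by simp
  have 1: "integrable circle_measure F"
  proof (rule integrable_const_bound)
    show "AE x in circle_measure. norm (F x) \<le> M"
      using AE_circle_norm AE_circle_notin[OF Z] by eventually_elim (simp add: eq M)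
  qed simp
  have 2: "integrable circle_measure (\<lambda>x. F (inverse x))"
  proof (rule integrable_const_bound)
    have "finite (inverse ` Z)" using Z by simp
    then have "AE x in circle_measure. x \<notin> inverse ` Z" by (rule AE_circle_notin)
    then show "AE x in circle_measure. norm (F (inverse x)) \<le> M"
      using AE_circle_norm
    proof eventually_elim
      case (elim x)
      then have "inverse x \<notin> Z" by (metis imageI inverse_inverse_eq)
      with elim show ?case by (simp add: eq M norm_inverse)
    qed
  qed simp
  show ?thesis
    using 1 2 by (simp add: circle_integral_inverse circle_mean_value[OF assms])
qed

abbreviation torus :: "nat set \<Rightarrow> (nat \<Rightarrow> complex) measure" where
  "torus A \<equiv> PiM A (\<lambda>_. circle_measure)"

lemma torus_component:
  "i \<in> A \<Longrightarrow> (\<lambda>z. z i) \<in> borel_measurable (torus A)"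
  using measurable_component_singleton[of i A "\<lambda>_. circle_measure"] by simp

lemma prob_space_torus: "prob_space (torus A)"
  by (intro prob_space_PiM prob_space_circle)

lemma AE_torus_norm:
  assumes "finite A" shows "AE z in torus A. \<forall>i\<in>A. norm (z i) = 1"
  using assms
  by (intro eventually_ball_finite ballI AE_PiM_component[where P = "\<lambda>x. norm x = 1"] prob_space_circle AE_circle_norm)

context koornwinder
begin

lemma cross_measurable [measurable (raw)]:
  assumes [measurable]: "f \<in> borel_measurable M" "g \<in> borel_measurable M"
  shows "(\<lambda>w. cross t (f w) (g w)) \<in> borel_measurable M"
  unfolding cross_def by measurable

lemma u_factor_measurable [measurable (raw)]:
  assumes [measurable]: "f \<in> borel_measurable M"
  shows "(\<lambda>w. u_factor a b t0 t1 t2 t3 l (f w)) \<in> borel_measurable M"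
  unfolding u_factor_def by (cases "l = 0") simp_all

lemma branch_measurable:
  assumes "f \<in> borel_measurable M" "\<And>i. i \<in> B \<Longrightarrow> (\<lambda>w. z w i) \<in> borel_measurable M"
  shows "(\<lambda>w. branch l (f w) B (z w)) \<in> borel_measurable M"
  unfolding branch_def using assms
  by (intro borel_measurable_times borel_measurable_prod u_factor_measurable cross_measurable)

lemma symsum_measurable:
  assumes "\<And>i. i \<in> A \<Longrightarrow> (\<lambda>w. z w i) \<in> borel_measurable M"
  shows "(\<lambda>w. symsum lam A (z w)) \<in> borel_measurable M"
  using assms
proof (induction lam arbitrary: A)
  case (Cons l lam)
  then show ?case unfolding symsum.simps
    by (intro borel_measurable_sum borel_measurable_times borel_measurable_add branch_measurable
        borel_measurable_inverse Cons.IH) auto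
qed simp

lemma half1_measurable [measurable (raw)]:
  assumes [measurable]: "f \<in> borel_measurable M"
  shows "(\<lambda>w. half1 (f w)) \<in> borel_measurable M"
  unfolding half1_def by measurable

lemma half2_measurable [measurable (raw)]:
  assumes [measurable]: "f \<in> borel_measurable M" "g \<in> borel_measurable M"
  shows "(\<lambda>w. half2 (f w) (g w)) \<in> borel_measurable M"
  unfolding half2_def by measurable

lemma density_measurable:
  assumes "\<And>i. i \<in> A \<Longrightarrow> (\<lambda>w. z w i) \<in> borel_measurable M"
  shows "(\<lambda>w. density A (z w)) \<in> borel_measurable M"
  unfolding density_def dens1_def dens2_def using assms
  by (intro borel_measurable_times borel_measurable_prod half1_measurable half2_measurable
      borel_measurable_inverse) auto

section \<open>Boundedness of the integrands\<close>

lemma norm_one_minus_le: "norm (1 - w) \<le> 2" if "norm w \<le> 1" for w :: complex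
  using norm_triangle_ineq4[of 1 w] that by simp

lemma norm_one_minus_ge: "1 - norm c \<le> norm (1 - c * x)" if "norm x = 1" for c x :: complex
  using norm_triangle_ineq2[of 1 "c * x"] that by (simp add: norm_mult)

lemma norm_one_minus_inverse: "norm (1 - inverse w) = norm (1 - w)" if "norm w = 1" for w :: complex
proof -
  have "w \<noteq> 0" using that by auto
  then have "1 - inverse w = - (1 - w) * inverse w" by (simp add: algebra_simps)
  then show ?thesis using that by (simp add: norm_mult norm_inverse norm_minus_commute)
qed

text \<open>
  On the circle \<open>|1 - x\<^sup>2| = |1 - x\<^sup>-\<^sup>2|\<close>, so the double zero of \<open>dens1\<close> matches the squared simple pole of \<open>u\<close>.
  Where the denominator of \<open>u\<close> is zero, \<open>u\<close> is \<open>0\<close> by convention.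
\<close>
lemma u_dens1_bounded: "\<exists>M. \<forall>x. norm x = 1 \<longrightarrow> norm (u_factor a b t0 t1 t2 t3 l x) ^ 2 * norm (dens1 x) \<le> M"
proof -
  define \<delta> where "\<delta> = (1 - norm t0) * (1 - norm t1) * (1 - norm t2) * (1 - norm t3)"
  have \<delta>: "\<delta> > 0" unfolding \<delta>_def using norm_t0 norm_t1 norm_t2 norm_t3 by simp
  have half: "norm (half1 x) \<le> norm (1 - x ^ 2) / \<delta>" if "norm x = 1" for x
  proof -
    have le: "\<delta> \<le> norm ((1 - t0 * x) * (1 - t1 * x) * (1 - t2 * x) * (1 - t3 * x))"
      unfolding \<delta>_def norm_mult using norm_t0 norm_t1 norm_t2 norm_t3 that
      by (intro mult_mono norm_one_minus_ge mult_nonneg_nonneg) auto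
    have "0 < norm ((1 - t0 * x) * (1 - t1 * x) * (1 - t2 * x) * (1 - t3 * x))"
      using \<delta> le by linarith
    then show ?thesis
      unfolding half1_def norm_divide by (intro divide_left_mono mult_pos_pos le \<delta>) auto
  qed
  have c: "norm (1 - c * inverse x) \<le> 2" if "norm c < 1" "norm x = 1" for c x :: complex
    using that by (intro norm_one_minus_le) (simp add: norm_mult norm_inverse)
  have u: "norm (u_factor a b t0 t1 t2 t3 l x) * norm (1 - x ^ 2) \<le> 16" if x: "norm x = 1" for x
  proof -
    have d: "norm (1 - inverse x ^ 2) = norm (1 - x ^ 2)"
      using norm_one_minus_inverse[of "x ^ 2"] x by (simp add: power_inverse norm_power)
    have 2: "norm ((1 - a * inverse x) * (1 - b * inverse x)) \<le> 2 * 2"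
      unfolding norm_mult using norm_a norm_b x by (intro mult_mono c) auto
    have 4: "norm ((1 - t0 * inverse x) * (1 - t1 * inverse x) * (1 - t2 * inverse x) * (1 - t3 * inverse x)) \<le> 2 * 2 * 2 * 2"
      unfolding norm_mult using norm_t0 norm_t1 norm_t2 norm_t3 x by (intro mult_mono c) auto
    show ?thesis
      unfolding u_factor_def using 2 4 x
      by (cases "x ^ 2 = 1") (auto simp: norm_divide d norm_mult norm_power power_inverse[symmetric])
  qed
  show ?thesis
  proof (intro exI allI impI)
    fix x :: complex assume x: "norm x = 1"
    let ?n = "norm (1 - x ^ 2)"
    have "norm (half1 (inverse x)) \<le> ?n / \<delta>"
      using half[of "inverse x"] norm_one_minus_inverse[of "x ^ 2"] x
      by (simp add: power_inverse norm_power norm_inverse)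
    then have "norm (dens1 x) \<le> (?n / \<delta>) * (?n / \<delta>)"
      unfolding dens1_def norm_mult using half[OF x] \<delta> by (intro mult_mono) auto
    then have "norm (u_factor a b t0 t1 t2 t3 l x) ^ 2 * norm (dens1 x)
        \<le> norm (u_factor a b t0 t1 t2 t3 l x) ^ 2 * ((?n / \<delta>) * (?n / \<delta>))"
      by (intro mult_left_mono) auto
    also have "\<dots> = (norm (u_factor a b t0 t1 t2 t3 l x) * ?n) ^ 2 / \<delta> ^ 2"
      by (simp add: power2_eq_square)
    also have "\<dots> \<le> 16 ^ 2 / \<delta> ^ 2"
      using u[OF x] by (intro divide_right_mono power_mono) auto
    finally show "norm (u_factor a b t0 t1 t2 t3 l x) ^ 2 * norm (dens1 x) \<le> 16 ^ 2 / \<delta> ^ 2" .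
  qed
qed

text \<open>The same comparison for the poles and zeros that involve two variables.\<close>
lemma cross_dens2_bounded: "\<exists>M. \<forall>x y. norm x = 1 \<longrightarrow> norm y = 1 \<longrightarrow> norm (cross t x y) ^ 2 * norm (dens2 x y) \<le> M"
proof -
  define \<delta> where "\<delta> = (1 - norm t) * (1 - norm t)"
  have \<delta>: "\<delta> > 0" unfolding \<delta>_def using norm_t by simp
  have half: "norm (half2 x y) \<le> norm ((1 - x * y) * (1 - x * inverse y)) / \<delta>" if "norm x = 1" "norm y = 1" for x y
  proof -
    have le: "\<delta> \<le> norm ((1 - t * (x * y)) * (1 - t * (x * inverse y)))"
      unfolding \<delta>_def norm_mult using norm_t that
      by (intro mult_mono norm_one_minus_ge) (auto simp: norm_mult norm_inverse)
    have "0 < norm ((1 - t * (x * y)) * (1 - t * (x * inverse y)))"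
      using \<delta> le by linarith
    then have "norm ((1 - x * y) * (1 - x * inverse y)) / norm ((1 - t * (x * y)) * (1 - t * (x * inverse y)))
      \<le> norm ((1 - x * y) * (1 - x * inverse y)) / \<delta>"
      by (intro divide_left_mono mult_pos_pos le \<delta>) auto
    then show ?thesis unfolding half2_def times_divide_times_eq norm_divide by (simp only: mult.assoc)
  qed
  show ?thesis
  proof (intro exI allI impI)
    fix x y :: complex assume x: "norm x = 1" and y: "norm y = 1"
    let ?p = "norm ((1 - x * y) * (1 - x * inverse y))"
    have p: "norm ((1 - inverse x * y) * (1 - inverse x * inverse y)) = ?p"
      using norm_one_minus_inverse[of "x * y"] norm_one_minus_inverse[of "x * inverse y"] x y
      by (simp add: norm_mult norm_inverse)
    have "norm (half2 (inverse x) y) \<le> ?p / \<delta>"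
      using half[of "inverse x" y] x y p by (simp add: norm_inverse)
    then have "norm (dens2 x y) \<le> (?p / \<delta>) * (?p / \<delta>)"
      unfolding dens2_def norm_mult[of "half2 x y"] using half[OF x y] \<delta> by (intro mult_mono) auto
    then have "norm (cross t x y) ^ 2 * norm (dens2 x y) \<le> norm (cross t x y) ^ 2 * ((?p / \<delta>) * (?p / \<delta>))"
      by (intro mult_left_mono) auto
    also have "\<dots> = (norm (cross t x y) * ?p) ^ 2 / \<delta> ^ 2"
      by (simp add: power2_eq_square)
    also have "\<dots> \<le> 4 ^ 2 / \<delta> ^ 2"
    proof (intro divide_right_mono power_mono)
      have "norm ((1 - t * inverse x * y) * (1 - t * inverse x * inverse y)) \<le> 2 * 2"
        unfolding norm_mult[of "1 - t * inverse x * y"] using norm_t x y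
        by (intro mult_mono norm_one_minus_le) (auto simp: norm_mult norm_inverse)
      then show "norm (cross t x y) * ?p \<le> 4"
        unfolding cross_def times_divide_times_eq norm_divide p by (cases "?p = 0") auto
    qed auto
    finally show "norm (cross t x y) ^ 2 * norm (dens2 x y) \<le> 4 ^ 2 / \<delta> ^ 2" .
  qed
qed

text \<open>
  A supremum form of square integrability against the density: such bounds multiply when a variable is
  added, as the density does.
\<close>
definition square_bounded :: "nat set \<Rightarrow> ((nat \<Rightarrow> complex) \<Rightarrow> complex) \<Rightarrow> bool" where
  "square_bounded A f \<longleftrightarrow>
     (\<exists>M. \<forall>z. (\<forall>i\<in>A. norm (z i) = 1) \<longrightarrow> norm (f z) ^ 2 * norm (density A z) \<le> M)"

lemma square_bounded_add:
  assumes "square_bounded A f" "square_bounded A g"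
  shows "square_bounded A (\<lambda>z. f z + g z)"
proof -
  obtain M N where M: "\<And>z. (\<forall>i\<in>A. norm (z i) = 1) \<Longrightarrow> norm (f z) ^ 2 * norm (density A z) \<le> M"
    and N: "\<And>z. (\<forall>i\<in>A. norm (z i) = 1) \<Longrightarrow> norm (g z) ^ 2 * norm (density A z) \<le> N"
    using assms unfolding square_bounded_def by metis
  have "norm (f z + g z) ^ 2 * norm (density A z) \<le> 2 * M + 2 * N" if z: "\<forall>i\<in>A. norm (z i) = 1" for z
  proof -
    have "norm (f z + g z) ^ 2 \<le> (norm (f z) + norm (g z)) ^ 2"
      by (intro power_mono norm_triangle_ineq) auto
    also have "\<dots> \<le> 2 * norm (f z) ^ 2 + 2 * norm (g z) ^ 2"
      using zero_le_power2[of "norm (f z) - norm (g z)"] by (simp add: power2_sum power2_diff)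
    finally have "norm (f z + g z) ^ 2 * norm (density A z)
       \<le> (2 * norm (f z) ^ 2 + 2 * norm (g z) ^ 2) * norm (density A z)"
      by (rule mult_right_mono) simp
    then show ?thesis using M[OF z] N[OF z] by (simp add: distrib_right)
  qed
  then show ?thesis unfolding square_bounded_def by blast
qed

lemma square_bounded_sum:
  assumes "finite I" "\<And>i. i \<in> I \<Longrightarrow> square_bounded A (f i)"
  shows "square_bounded A (\<lambda>z. \<Sum>i\<in>I. f i z)"
  using assms
proof (induction I)
  case empty
  then show ?case by (auto simp: square_bounded_def intro!: exI[of _ 0])
next
  case (insert i I)
  then show ?case by (simp add: square_bounded_add)
qed

lemma square_bounded_branch:
  assumes fin: "finite B" and k: "k \<notin> B" and f: "square_bounded B f"
    and g: "g = (\<lambda>x. x) \<or> g = inverse"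
  shows "square_bounded (insert k B) (\<lambda>z. branch l (g (z k)) B z * f z)"
proof -
  obtain M1 where M1: "\<And>x. norm x = 1 \<Longrightarrow> norm (u_factor a b t0 t1 t2 t3 l x) ^ 2 * norm (dens1 x) \<le> M1"
    using u_dens1_bounded by blast
  obtain M2 where M2: "\<And>x y. norm x = 1 \<Longrightarrow> norm y = 1 \<Longrightarrow> norm (cross t x y) ^ 2 * norm (dens2 x y) \<le> M2"
    using cross_dens2_bounded by blast
  obtain M3 where M3: "\<And>z. (\<forall>i\<in>B. norm (z i) = 1) \<Longrightarrow> norm (f z) ^ 2 * norm (density B z) \<le> M3"
    using f unfolding square_bounded_def by blast
  have "norm (branch l (g (z k)) B z * f z) ^ 2 * norm (density (insert k B) z) \<le> M1 * (\<Prod>j\<in>B. M2) * M3"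
    if z: "\<forall>i\<in>insert k B. norm (z i) = 1" for z
  proof -
    define x where "x = g (z k)"
    have x: "norm x = 1" "dens1 x = dens1 (z k)" "dens2 x y = dens2 (z k) y" for y
      using g z by (auto simp: x_def norm_inverse)
    have "norm (branch l x B z * f z) ^ 2 * norm (density (insert k B) z)
      = (norm (u_factor a b t0 t1 t2 t3 l x) ^ 2 * norm (dens1 x)) *
        (\<Prod>j\<in>B. norm (cross t x (z j)) ^ 2 * norm (dens2 x (z j))) * (norm (f z) ^ 2 * norm (density B z))"
      unfolding density_insert[OF fin k] branch_def x(2)[symmetric] x(3)[symmetric]
        norm_mult prod_norm[symmetric] prod.distrib power_mult_distrib prod_power_distrib[symmetric]
      by (simp only: ac_simps)
    also have "\<dots> \<le> M1 * (\<Prod>j\<in>B. M2) * M3"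
      using z x(1) order.trans[OF _ M1[OF x(1)], of 0] order.trans[OF _ M3, of 0 z]
      by (intro mult_mono prod_mono mult_nonneg_nonneg prod_nonneg conjI M1 M2 M3)
        (auto intro: order.trans[OF _ M2[OF x(1), of "z _"]])
    finally show ?thesis by (simp only: x_def)
  qed
  then show ?thesis unfolding square_bounded_def by blast
qed

lemma square_bounded_branches:
  assumes "finite A" "k \<in> A" "square_bounded (A - {k}) f"
  shows "square_bounded A (\<lambda>z. branches l k (A - {k}) z * f z)"
proof -
  have "square_bounded (insert k (A - {k})) (\<lambda>z. branch l (z k) (A - {k}) z * f z)"
    "square_bounded (insert k (A - {k})) (\<lambda>z. branch l (inverse (z k)) (A - {k}) z * f z)"
    using square_bounded_branch[of "A - {k}" k f "\<lambda>x. x"] square_bounded_branch[of "A - {k}" k f inverse] assms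
    by auto
  then have "square_bounded (insert k (A - {k})) (\<lambda>z. branch l (z k) (A - {k}) z * f z + branch l (inverse (z k)) (A - {k}) z * f z)"
    by (rule square_bounded_add)
  then show ?thesis using assms(2) by (simp add: branches_def distrib_right insert_absorb)
qed

lemma square_bounded_symsum:
  assumes "finite A" "length lam = card A"
  shows "square_bounded A (symsum lam A)"
  using assms
proof (induction lam arbitrary: A)
  case Nil
  then show ?case by (auto simp: square_bounded_def density_def)
next
  case (Cons l lam)
  have "square_bounded (A - {k}) (symsum lam (A - {k}))" if "k \<in> A" for k
    using that Cons.prems by (intro Cons.IH) auto
  then show ?case
    using Cons.prems unfolding symsum_Cons[abs_def]
    by (intro square_bounded_sum square_bounded_branches)
qed

text \<open>Since \<open>|f g| \<le> |f|\<^sup>2 + |g|\<^sup>2\<close>, the integrand is bounded almost everywhere.\<close>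
lemma integrable_square_bounded:
  assumes fin: "finite A" and f: "square_bounded A f" "f \<in> borel_measurable (torus A)"
    and g: "square_bounded A g" "g \<in> borel_measurable (torus A)"
  shows "integrable (torus A) (\<lambda>z. f z * g z * density A z)"
proof -
  interpret prob_space "torus A" by (rule prob_space_torus)
  obtain M N where M: "\<And>z. (\<forall>i\<in>A. norm (z i) = 1) \<Longrightarrow> norm (f z) ^ 2 * norm (density A z) \<le> M"
    and N: "\<And>z. (\<forall>i\<in>A. norm (z i) = 1) \<Longrightarrow> norm (g z) ^ 2 * norm (density A z) \<le> N"
    using f(1) g(1) unfolding square_bounded_def by metis
  have D: "density A \<in> borel_measurable (torus A)"
    by (rule density_measurable[of A "\<lambda>z. z", simplified]) (rule torus_component)
  show ?thesis
  proof (rule integrable_const_bound)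
    show "AE z in torus A. norm (f z * g z * density A z) \<le> M + N"
      using AE_torus_norm[OF fin]
    proof eventually_elim
      case (elim z)
      have "norm (f z) * norm (g z) \<le> norm (f z) ^ 2 + norm (g z) ^ 2"
      proof -
        have "2 * (norm (f z) * norm (g z)) \<le> norm (f z) ^ 2 + norm (g z) ^ 2"
          using sum_squares_bound[of "norm (f z)" "norm (g z)"] by (simp only: mult.assoc)
        moreover have "0 \<le> norm (f z) * norm (g z)" by simp
        ultimately show ?thesis by linarith
      qed
      then have "norm (f z) * norm (g z) * norm (density A z)
          \<le> (norm (f z) ^ 2 + norm (g z) ^ 2) * norm (density A z)"
        by (rule mult_right_mono) simp
      then show ?case using M[OF elim] N[OF elim] by (simp add: norm_mult distrib_right)
    qed
    show "(\<lambda>z. f z * g z * density A z) \<in> borel_measurable (torus A)"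
      by (intro borel_measurable_times f(2) g(2) D)
  qed
qed

section \<open>Integrating out the variable of the largest part\<close>

lemma symsum_measurable_torus: "B \<subseteq> A \<Longrightarrow> symsum lam B \<in> borel_measurable (torus A)"
  by (rule symsum_measurable[of B "\<lambda>z. z", simplified]) (auto intro: torus_component)

lemma branches_measurable_torus: "k \<in> A \<Longrightarrow> branches l k (A - {k}) \<in> borel_measurable (torus A)"
  unfolding branches_def[abs_def]
  by (intro borel_measurable_add branch_measurable borel_measurable_inverse torus_component) auto

definition pairing :: "nat set \<Rightarrow> nat list \<Rightarrow> nat list \<Rightarrow> complex" where
  "pairing A lam mu = (LINT z|torus A. symsum lam A z * symsum mu A z * density A z)"

lemma pairing_commute: "pairing A lam mu = pairing A mu lam"
  unfolding pairing_def by (simp add: mult.commute)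

lemma integrable_pairing:
  assumes "finite A" "length lam = card A" "length mu = card A"
  shows "integrable (torus A) (\<lambda>z. symsum lam A z * symsum mu A z * density A z)"
  using assms by (intro integrable_square_bounded square_bounded_symsum symsum_measurable_torus) auto

text \<open>The halves of the density at \<open>1/x\<close> cancel all poles of \<open>branch l x\<close>, as \<open>l > 0\<close>.\<close>
lemma branch_densities:
  assumes "off_poles B z x" "\<And>j. j \<in> B \<Longrightarrow> norm (z j) = 1" "l > 0"
  shows "branch l x B z * (dens1 x * (\<Prod>j\<in>B. dens2 x (z j))) = peel_weight l B z x"
proof -
  have x: "norm x = 1" "x \<noteq> 0" "x ^ 2 \<noteq> 1" using assms(1) by (auto simp: off_poles_def)
  then have c: "1 - inverse x ^ 2 \<noteq> 0" by (simp add: power_inverse)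
  have "den (inverse x) \<noteq> 0" using x by (intro den_nonzero) (simp add: norm_inverse)
  moreover have "u_factor a b t0 t1 t2 t3 l x = x ^ l * den (inverse x) / (1 - inverse x ^ 2)"
    using assms(3) by (simp add: u_factor_def den_def)
  ultimately have u: "u_factor a b t0 t1 t2 t3 l x * half1 (inverse x) = x ^ l"
    unfolding half1_den using c by simp
  have p: "(\<Prod>j\<in>B. cross t x (z j)) * (\<Prod>j\<in>B. half2 (inverse x) (z j)) = 1"
    unfolding prod.distrib[symmetric]
    using cross_mult_half2_inverse off_polesD[OF assms(1)] assms(2) by (intro prod.neutral ballI) blast
  have "branch l x B z * (dens1 x * (\<Prod>j\<in>B. dens2 x (z j))) =
    (u_factor a b t0 t1 t2 t3 l x * half1 (inverse x)) * half1 x * (\<Prod>j\<in>B. half2 x (z j)) *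
    ((\<Prod>j\<in>B. cross t x (z j)) * (\<Prod>j\<in>B. half2 (inverse x) (z j)))"
    unfolding branch_def dens1_def dens2_def prod.distrib by (simp only: ac_simps)
  then show ?thesis unfolding u p peel_weight_def by simp
qed

text \<open>
  The two signs of \<open>x\<close> contribute equally, and the positive one has the holomorphic continuation of
  \<open>peel_weight_symsum_extends\<close>.
\<close>
lemma integral_largest_variable:
  assumes "l > 0" "sorted_wrt (\<ge>) mu" "\<And>m. m \<in> set mu \<Longrightarrow> m \<le> l"
    and "finite B" "k \<notin> B" "length mu = Suc (card B)" "\<And>j. j \<in> B \<Longrightarrow> norm (z j) = 1"
  shows "(LINT x|circle_measure. branches l k B (z(k := x)) *
      (symsum mu (insert k B) (z(k := x)) * (dens1 x * (\<Prod>j\<in>B. dens2 x (z j)))))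
    = 2 * (peel_factor l mu * symsum (tl mu) B z)"
proof -
  obtain H where H: "H holomorphic_on cball 0 1" "H 0 = peel_factor l mu * symsum (tl mu) B z"
    "\<And>x. off_poles B z x \<Longrightarrow> peel_weight l B z x * symsum mu (insert k B) (z(k := x)) = H x"
  proof -
    have "\<exists>H. H holomorphic_on cball 0 1 \<and> H 0 = peel_factor l mu * symsum (tl mu) B z \<and>
      (\<forall>x. off_poles B z x \<longrightarrow> peel_weight l B z x * symsum mu (insert k B) (z(k := x)) = H x)"
      by (rule peel_weight_symsum_extends) (use assms in auto)
    then show ?thesis using that by blast
  qed
  define P where "P x = symsum mu (insert k B) (z(k := x)) * (dens1 x * (\<Prod>j\<in>B. dens2 x (z j)))" for x
  define F where "F x = branch l x B z * P x" for x
  have meas: "F \<in> borel_measurable borel"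
    unfolding F_def P_def dens1_def dens2_def
    by (intro borel_measurable_times borel_measurable_prod branch_measurable symsum_measurable
        half1_measurable half2_measurable borel_measurable_inverse) auto
  define Z where "Z = {1, -1} \<union> z ` B \<union> (\<lambda>j. inverse (z j)) ` B"
  have "F x = H x" if x: "norm x = 1" "x \<notin> Z" for x
  proof -
    have "x ^ 2 \<noteq> 1" using x by (auto simp: Z_def power2_eq_1_iff)
    moreover have "x \<noteq> z j \<and> x * z j \<noteq> 1" if "j \<in> B" for j
      using that x inverse_unique[of "z j" x] by (auto simp: Z_def mult.commute)
    ultimately have g: "off_poles B z x" using x by (auto simp: off_poles_def)
    have "F x = branch l x B z * (dens1 x * (\<Prod>j\<in>B. dens2 x (z j))) * symsum mu (insert k B) (z(k := x))"
      unfolding F_def P_def by (simp only: ac_simps)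
    then show ?thesis using branch_densities[OF g assms(7,1)] H(3)[OF g] by simp
  qed
  moreover have "finite Z" using assms(4) by (simp add: Z_def)
  ultimately have "(LINT x|circle_measure. F x + F (inverse x)) = 2 * H 0"
    using meas H(1) by (intro circle_symmetrised_mean_value)
  moreover have "P (inverse x) = P x" for x
  proof -
    have "symsum mu (insert k B) (z(k := inverse x)) = symsum mu (insert k B) (z(k := x))"
      by (rule symsum_inverse) auto
    then show ?thesis by (simp add: P_def)
  qed
  moreover have "branch l y B (z(k := x)) = branch l y B z" for y x
    unfolding branch_def using assms(5) by (intro arg_cong2[of _ _ _ _ "(*)"] prod.cong) auto
  ultimately show ?thesis
    by (simp add: F_def P_def[symmetric] branches_def distrib_right H(2))
qed

text \<open>
  The recursion expands the first factor \<open>symsum (l # lam)\<close> over the variable \<open>k\<close> that receives \<open>l\<close>.  Each summand is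
  integrable by itself, so Fubini's theorem applies to it and the integral over \<open>z\<^sub>k\<close> can be done first.
\<close>
lemma pairing_peel:
  assumes l: "l > 0" and mu: "sorted_wrt (\<ge>) mu" "\<And>m. m \<in> set mu \<Longrightarrow> m \<le> l"
    and fin: "finite A" and len: "length mu = card A" "Suc (length lam) = card A"
  shows "pairing A (l # lam) mu = (\<Sum>k\<in>A. 2 * peel_factor l mu * pairing (A - {k}) lam (tl mu))"
proof -
  define T where "T k z = (branches l k (A - {k}) z * symsum lam (A - {k}) z) * symsum mu A z * density A z" for k z
  have int: "integrable (torus A) (T k)" if k: "k \<in> A" for k
    unfolding T_def[abs_def]
  proof (intro integrable_square_bounded fin square_bounded_branches k square_bounded_symsum
      borel_measurable_times branches_measurable_torus symsum_measurable_torus)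
    show "length lam = card (A - {k})" using len fin k by simp
  qed (use fin len in auto)
  have "pairing A (l # lam) mu = (LINT z|torus A. (\<Sum>k\<in>A. T k z))"
    unfolding pairing_def symsum_Cons T_def by (simp add: sum_distrib_right)
  also have "\<dots> = (\<Sum>k\<in>A. integral\<^sup>L (torus A) (T k))"
    using int by simp
  also have "\<dots> = (\<Sum>k\<in>A. 2 * peel_factor l mu * pairing (A - {k}) lam (tl mu))"
  proof (intro sum.cong refl)
    fix k assume k: "k \<in> A"
    define B where "B = A - {k}"
    have B: "finite B" "k \<notin> B" "A = insert k B" using fin k by (auto simp: B_def)
    have psf: "product_sigma_finite (\<lambda>_::nat. circle_measure)"
      by (simp add: product_sigma_finite_def prob_space_imp_sigma_finite prob_space_circle)
    have "integral\<^sup>L (torus A) (T k) = (LINT z|torus B. (LINT x|circle_measure. T k (z(k := x))))"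
      using product_sigma_finite.product_integral_insert[OF psf B(1,2)] int[OF k] unfolding B(3) by blast
    also have "\<dots> = (LINT z|torus B. 2 * peel_factor l mu * (symsum lam B z * symsum (tl mu) B z * density B z))"
    proof (rule integral_cong_AE)
      have "T k \<in> borel_measurable (torus (insert k B))"
        using int[OF k] unfolding B(3) by (rule borel_measurable_integrable)
      then have "(\<lambda>(z, x). T k (z(k := x))) \<in> borel_measurable (torus B \<Otimes>\<^sub>M circle_measure)"
        using measurable_compose[OF measurable_add_dim] by (simp add: case_prod_beta')
      then show "(\<lambda>z. LINT x|circle_measure. T k (z(k := x))) \<in> borel_measurable (torus B)"
        by (intro sigma_finite_measure.borel_measurable_lebesgue_integral prob_space_imp_sigma_finite prob_space_circle)
      show "(\<lambda>z. 2 * peel_factor l mu * (symsum lam B z * symsum (tl mu) B z * density B z)) \<in> borel_measurable (torus B)"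
        using density_measurable[of B "\<lambda>z. z" "torus B"]
        by (intro borel_measurable_times borel_measurable_const symsum_measurable_torus) (auto intro: torus_component)
      show "AE z in torus B. (LINT x|circle_measure. T k (z(k := x)))
          = 2 * peel_factor l mu * (symsum lam B z * symsum (tl mu) B z * density B z)"
        using AE_torus_norm[OF B(1)]
      proof eventually_elim
        case (elim z)
        have 1: "symsum lam B (z(k := x)) = symsum lam B z" for x
          by (rule symsum_cong) (use B in auto)
        have 2: "density (insert k B) (z(k := x)) = dens1 x * (\<Prod>j\<in>B. dens2 x (z j)) * density B z" for x
        proof -
          have "density B (z(k := x)) = density B z"
            by (rule density_cong) (use B in auto)
          moreover have "(\<Prod>j\<in>B. dens2 x ((z(k := x)) j)) = (\<Prod>j\<in>B. dens2 x (z j))"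
            using B by (intro prod.cong) auto
          ultimately show ?thesis by (simp add: density_insert[OF B(1,2)])
        qed
        have "T k (z(k := x)) = (symsum lam B z * density B z) * (branches l k B (z(k := x)) *
            (symsum mu (insert k B) (z(k := x)) * (dens1 x * (\<Prod>j\<in>B. dens2 x (z j)))))" for x
          unfolding T_def B_def[symmetric] 1 unfolding B(3) 2 by (simp only: ac_simps)
        moreover have "length mu = Suc (card B)" using len B by simp
        ultimately show ?case
          using integral_largest_variable[OF l mu B(1,2), of z] elim by simp
      qed
    qed
    also have "\<dots> = 2 * peel_factor l mu * pairing (A - {k}) lam (tl mu)"
      by (simp add: pairing_def B_def)
    finally show "integral\<^sup>L (torus A) (T k) = 2 * peel_factor l mu * pairing (A - {k}) lam (tl mu)" .
  qed
  finally show ?thesis .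
qed

end

section \<open>The normalising constants\<close>

lemma part_mult_filter: "part_mult i lam = length (filter (\<lambda>x. x = i) lam)"
  by (simp add: part_mult_def length_filter_conv_card)

lemma part_mult_Nil [simp]: "part_mult i [] = 0"
  by (simp add: part_mult_filter)

lemma part_mult_Cons [simp]: "part_mult i (l # lam) = (if l = i then Suc (part_mult i lam) else part_mult i lam)"
  by (simp add: part_mult_filter)

lemma part_mult_notin: "i \<notin> set lam \<Longrightarrow> part_mult i lam = 0"
  by (induction lam) auto

lemma part_mult_replicate [simp]: "part_mult i (replicate m j) = (if i = j then m else 0)"
  by (simp add: part_mult_filter)

lemma replicate_of_all_zero: "(\<And>m. m \<in> set mu \<Longrightarrow> m = 0) \<Longrightarrow> mu = replicate (length mu) (0::nat)"
  by (induction mu) auto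

context koornwinder
begin

lemma t_power_nonzero: "j \<ge> 1 \<Longrightarrow> 1 - t ^ j \<noteq> 0"
  using norm_t power_less_one_iff[of "norm t" j] by (intro one_minus_nonzero) (simp add: norm_power)

lemma norm_mult_less_one: "norm x < 1 \<Longrightarrow> norm y \<le> 1 \<Longrightarrow> norm (x * y) < 1" for x y :: complex
  using mult_left_le[of "norm y" "norm x"] by (simp add: norm_mult)

lemma norm_t0123: "norm (t0 * t1 * t2 * t3) < 1"
  using norm_t0 norm_t1 norm_t2 norm_t3 by (intro norm_mult_less_one) auto

lemma norm_t_power_le: "norm (t ^ j) \<le> 1"
  using norm_t by (simp add: norm_power power_le_one)

lemma v_zero_nonzero: "v_zero m \<noteq> 0"
proof -
  have "norm (a * b * t ^ j) < 1" for j
    using norm_a norm_b norm_t_power_le by (intro norm_mult_less_one) auto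
  then have "1 - a * b * t ^ j \<noteq> 0" for j by (rule one_minus_nonzero)
  moreover have "1 - t \<noteq> 0" using norm_t by (rule one_minus_nonzero)
  ultimately show ?thesis using t_power_nonzero by (simp add: v_zero_def del: right_minus_eq)
qed

lemma v_plus_nonzero: "v_plus t t0 t1 t2 t3 lam \<noteq> 0"
proof -
  have "norm (t0 * t1 * t2 * t3 * t ^ j) < 1" for j
    using norm_t0123 norm_t_power_le by (rule norm_mult_less_one)
  then have "1 - t0 * t1 * t2 * t3 * t ^ j \<noteq> 0" for j by (rule one_minus_nonzero)
  moreover have "1 - t \<noteq> 0" using norm_t by (rule one_minus_nonzero)
  ultimately show ?thesis using t_power_nonzero by (simp add: v_plus_def del: right_minus_eq)
qed

text \<open>The zero parts contribute the constant of the zero partition.\<close>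
lemma v_factor_split:
  "v_factor t a b t0 t1 t2 t3 lam = v_plus t t0 t1 t2 t3 lam * v_zero (part_mult 0 lam)"
proof -
  define P where "P i = (\<Prod>j\<in>{1..part_mult i lam}. (1 - t ^ j) / (1 - t))" for i
  have "(\<Prod>i\<in>set lam. P i) = P 0 * (\<Prod>i\<in>set lam - {0}. P i)"
    by (cases "0 \<in> set lam") (auto simp: prod.remove P_def part_mult_notin)
  then show ?thesis
    unfolding v_factor_def v_plus_def v_zero_def P_def[symmetric] by (simp only: ac_simps)
qed

text \<open>
  For \<open>l > 1\<close> this is the geometric sum \<open>1 + t + \<dots> + t\<^sup>p\<^sup>-\<^sup>1\<close>.  For \<open>l = 1\<close> all parts of \<open>mu\<close> are \<open>0\<close> or \<open>1\<close>, so
  \<open>length mu\<close> is the sum of the two multiplicities and a second geometric sum is subtracted.  If \<open>l\<close> does not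
  occur, the first factor is \<open>0\<close>, which makes the truncated subtraction harmless.
\<close>
lemma peel_factor_closed_form:
  assumes "sorted_wrt (\<ge>) mu" "\<And>m. m \<in> set mu \<Longrightarrow> m \<le> l" "l > 0"
  shows "peel_factor l mu = (1 - t ^ part_mult l mu) / (1 - t) *
    (if l = 1 then 1 - t0 * t1 * t2 * t3 * t ^ (part_mult 1 mu - 1 + 2 * part_mult 0 mu) else 1)"
  using assms
proof (induction mu)
  case (Cons x mu)
  show ?case
  proof (cases "x = l")
    case False
    then have "x < l" using Cons.prems(2)[of x] by simp
    then have "l \<notin> set (x # mu)" using Cons.prems(1) by auto
    then show ?thesis by (simp add: peel_factor_notin part_mult_notin del: peel_factor.simps part_mult_Cons)
  next
    case True
    define T where "T = t0 * t1 * t2 * t3"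
    define p where "p = part_mult l mu"
    define q where "q = part_mult 0 mu"
    have t1: "1 - t \<noteq> 0" using norm_t by (rule one_minus_nonzero)
    have IH: "peel_factor l mu = (1 - t ^ p) / (1 - t) * (if l = 1 then 1 - T * t ^ (part_mult 1 mu - 1 + 2 * q) else 1)"
      unfolding p_def q_def T_def using Cons by auto
    show ?thesis
    proof (cases "l = 1")
      case False
      have "1 + t * ((1 - t ^ p) / (1 - t)) = (1 - t ^ Suc p) / (1 - t)"
        using t1 by (simp add: field_simps)
      then show ?thesis using True False IH Cons.prems(3) by (simp add: p_def)
    next
      case l1: True
      have "length mu = part_mult 1 mu + part_mult 0 mu"
      proof -
        have "length xs = part_mult 1 xs + part_mult 0 xs" if "\<forall>m\<in>set xs. m \<le> 1" for xs
          using that by (induction xs) (auto simp: le_Suc_eq)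
        then show ?thesis using Cons.prems l1 by auto
      qed
      then have len: "length mu = p + q" using l1 by (simp add: p_def q_def)
      have "1 - T * t ^ (2 * (p + q)) + t * ((1 - t ^ p) / (1 - t) * (1 - T * t ^ (p - 1 + 2 * q)))
        = (1 - t ^ Suc p) / (1 - t) * (1 - T * t ^ (p + 2 * q))"
      proof (cases p)
        case (Suc p')
        have "(1 - t) * (1 - T * t ^ (2 * (Suc p' + q))) + t * ((1 - t ^ Suc p') * (1 - T * t ^ (p' + 2 * q)))
          = (1 - t ^ Suc (Suc p')) * (1 - T * t ^ (Suc p' + 2 * q))"
          by (simp add: power_add power_mult power2_eq_square algebra_simps)
        then show ?thesis using t1 Suc by (simp add: field_simps del: power_Suc)
      qed (use t1 in simp)
      then show ?thesis
        using True l1 IH len by (simp add: p_def[symmetric] q_def[symmetric] T_def[symmetric] del: power_Suc) (simp add: p_def)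
    qed
  qed
qed simp

text \<open>Prepending \<open>l\<close> adds one factor to the product over \<open>j\<close> for \<open>l\<close> and, for \<open>l = 1\<close>, one to the second product.\<close>
lemma v_plus_Cons:
  assumes "sorted_wrt (\<ge>) (l # lam)" "l > 0"
  shows "v_plus t t0 t1 t2 t3 (l # lam) = peel_factor l (l # lam) * v_plus t t0 t1 t2 t3 lam"
proof -
  define P where "P k = (\<Prod>j\<in>{1..k}. (1 - t ^ j) / (1 - t))" for k
  define Q where "Q k = (\<Prod>i\<in>{1..k}. 1 - t0 * t1 * t2 * t3 * t ^ (i - 1 + 2 * part_mult 0 lam))" for k
  let ?m = "part_mult l lam"
  have P: "P (Suc ?m) = (1 - t ^ Suc ?m) / (1 - t) * P ?m" by (simp add: P_def)
  have "set (l # lam) - {0} = insert l (set lam - {0} - {l})" using assms by auto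
  then have "(\<Prod>i\<in>set (l # lam) - {0}. P (part_mult i (l # lam)))
     = P (Suc ?m) * (\<Prod>i\<in>set lam - {0} - {l}. P (part_mult i (l # lam)))"
    by (simp only: prod.insert finite_Diff finite_set Diff_iff insert_iff simp_thms part_mult_Cons if_True)
  also have "(\<Prod>i\<in>set lam - {0} - {l}. P (part_mult i (l # lam))) = (\<Prod>i\<in>set lam - {0} - {l}. P (part_mult i lam))"
    by (intro prod.cong) auto
  also have "P (Suc ?m) * \<dots> = (1 - t ^ Suc ?m) / (1 - t) * (P ?m * \<dots>)"
    unfolding P by simp
  also have "P ?m * (\<Prod>i\<in>set lam - {0} - {l}. P (part_mult i lam)) = (\<Prod>i\<in>set lam - {0}. P (part_mult i lam))"
    using assms by (cases "l \<in> set lam") (auto simp: prod.remove[of _ l] part_mult_notin P_def)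
  finally have 1: "(\<Prod>i\<in>set (l # lam) - {0}. P (part_mult i (l # lam)))
      = (1 - t ^ Suc ?m) / (1 - t) * (\<Prod>i\<in>set lam - {0}. P (part_mult i lam))" .
  have 2: "Q (part_mult 1 (l # lam)) = (if l = 1 then 1 - t0 * t1 * t2 * t3 * t ^ (?m + 2 * part_mult 0 lam) else 1) * Q (part_mult 1 lam)"
    by (simp add: Q_def)
  have "m \<le> l" if "m \<in> set (l # lam)" for m using that assms by auto
  from peel_factor_closed_form[OF assms(1) this assms(2)]
  have "peel_factor l (l # lam) = (1 - t ^ Suc ?m) / (1 - t) *
      (if l = 1 then 1 - t0 * t1 * t2 * t3 * t ^ (?m + 2 * part_mult 0 lam) else 1)"
    by (auto simp del: peel_factor.simps power_Suc)
  moreover have "part_mult 0 (l # lam) = part_mult 0 lam" using assms by simp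
  then have "v_plus t t0 t1 t2 t3 (l # lam)
      = (\<Prod>i\<in>set (l # lam) - {0}. P (part_mult i (l # lam))) * Q (part_mult 1 (l # lam))"
    unfolding v_plus_def P_def Q_def by (simp only:)
  moreover have "v_plus t t0 t1 t2 t3 lam = (\<Prod>i\<in>set lam - {0}. P (part_mult i lam)) * Q (part_mult 1 lam)"
    unfolding v_plus_def P_def Q_def by (simp only:)
  ultimately show ?thesis by (simp only: 1 2 ac_simps)
qed

section \<open>Orthogonality\<close>

lemma density_nongeneric:
  assumes "finite A" "\<And>i. i \<in> A \<Longrightarrow> norm (z i) = 1" "\<not> generic A z"
  shows "density A z = 0"
proof -
  have nz: "z i \<noteq> 0" if "i \<in> A" for i using assms(2)[OF that] by auto
  consider i where "i \<in> A" "z i ^ 2 = 1" | i j where "i \<in> A" "j \<in> A" "i \<noteq> j" "z i = z j \<or> z i * z j = 1"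
    using assms(3) nz unfolding generic_def by blast
  then show ?thesis
  proof cases
    case 1
    have "A = insert i (A - {i})" using 1 by auto
    moreover have "density (insert i (A - {i})) z = 0"
      using 1 assms(1) by (subst density_insert) (auto simp: dens1_def half1_def)
    ultimately show ?thesis by simp
  next
    case 2
    have "A = insert i (A - {i})" using 2 by auto
    moreover have "dens2 (z i) (z j) = 0"
      using 2 nz[of j] by (auto simp: dens2_def half2_def)
    then have "(\<Prod>j\<in>A - {i}. dens2 (z i) (z j)) = 0"
      using 2 assms(1) by (intro prod_zero) auto
    then have "density (insert i (A - {i})) z = 0"
      using assms(1) by (subst density_insert) auto
    ultimately show ?thesis by simp
  qed
qed

text \<open>Off the generic points, where \<open>symsum_zero_generic\<close> says nothing, the density vanishes.\<close>
lemma symsum_zero_density: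
  assumes "finite A" "\<And>i. i \<in> A \<Longrightarrow> norm (z i) = 1" "card A = m"
  shows "symsum (replicate m 0) A z * density A z = v_zero m * density A z"
  using symsum_zero_generic[of A z m] density_nongeneric[of A z] assms by (cases "generic A z") auto

lemma density_reindex:
  assumes "finite B" "inj_on f B"
  shows "density (f ` B) z = density B (\<lambda>i. z (f i))"
  using assms
proof (induction B)
  case (insert k B)
  then have "f k \<notin> f ` B" by auto
  with insert show ?case by (simp add: density_insert prod.reindex)
qed (simp add: density_def)

text \<open>Relabelling the variables.\<close>
lemma density_integral_card:
  assumes "finite A"
  shows "integral\<^sup>L (torus A) (density A) = integral\<^sup>L (torus_measure (card A)) (density {..<card A})"
proof -
  obtain f where f: "bij_betw f {..<card A} A"
    using bij_betw_from_nat_into_finite[OF assms] by blast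
  let ?I = "{..<card A}"
  have inj: "inj_on f ?I" "f ` ?I = A" "f \<in> ?I \<rightarrow> A" using f by (auto simp: bij_betw_def)
  have "torus ?I = distr (torus A) (torus ?I) (\<lambda>\<omega>. \<lambda>n\<in>?I. \<omega> (f n))"
    by (rule distr_PiM_reindex[symmetric]) (use inj prob_space_circle in auto)
  then have "integral\<^sup>L (torus ?I) (density ?I) = integral\<^sup>L (distr (torus A) (torus ?I) (\<lambda>\<omega>. \<lambda>n\<in>?I. \<omega> (f n))) (density ?I)"
    by simp
  also have "\<dots> = (LINT \<omega>|torus A. density ?I (\<lambda>n\<in>?I. \<omega> (f n)))"
  proof (rule integral_distr)
    show "(\<lambda>\<omega>. \<lambda>n\<in>?I. \<omega> (f n)) \<in> torus A \<rightarrow>\<^sub>M torus ?I"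
      using inj(3) by (intro measurable_restrict measurable_component_singleton) auto
    show "density ?I \<in> borel_measurable (torus ?I)"
      by (rule density_measurable[of _ "\<lambda>z. z", simplified]) (rule torus_component)
  qed
  also have "\<dots> = integral\<^sup>L (torus A) (density A)"
  proof (rule Bochner_Integration.integral_cong[OF refl])
    fix \<omega>
    have "density ?I (\<lambda>n\<in>?I. \<omega> (f n)) = density ?I (\<lambda>n. \<omega> (f n))"
      by (rule density_cong) simp
    then show "density ?I (\<lambda>n\<in>?I. \<omega> (f n)) = density A \<omega>"
      using density_reindex[of ?I f \<omega>] inj by simp
  qed
  finally show ?thesis by (simp add: torus_measure_def)
qed

lemma pairing_zero:
  assumes "finite A" "card A = m"
  shows "pairing A (replicate m 0) (replicate m 0)
    = v_zero m ^ 2 * integral\<^sup>L (torus_measure m) (density {..<m})"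
proof -
  let ?S = "symsum (replicate m 0) A"
  have D: "density A \<in> borel_measurable (torus A)"
    by (rule density_measurable[of _ "\<lambda>z. z", simplified]) (rule torus_component)
  have "pairing A (replicate m 0) (replicate m 0) = (LINT z|torus A. v_zero m ^ 2 * density A z)"
    unfolding pairing_def
  proof (rule integral_cong_AE)
    show "AE z in torus A. ?S z * ?S z * density A z = v_zero m ^ 2 * density A z"
      using AE_torus_norm[OF assms(1)]
    proof eventually_elim
      case (elim z)
      then have *: "?S z * density A z = v_zero m * density A z"
        using symsum_zero_density[of A z m] assms by auto
      have "?S z * ?S z * density A z = ?S z * (?S z * density A z)" by (simp only: ac_simps)
      also have "\<dots> = ?S z * (v_zero m * density A z)" by (simp only: *)
      also have "\<dots> = v_zero m * (?S z * density A z)" by (rule mult.left_commute)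
      also have "\<dots> = v_zero m ^ 2 * density A z" unfolding * by (simp add: power2_eq_square)
      finally show ?case .
    qed
  qed (intro borel_measurable_times borel_measurable_const symsum_measurable_torus D order.refl)+
  then show ?thesis using density_integral_card[OF assms(1)] assms(2) by simp
qed

text \<open>
  By symmetry the first part of \<open>lam\<close> may be assumed not to be smaller than that of \<open>mu\<close>.  If it is positive, \<open>pairing_peel\<close>
  removes it, with one summand for each variable and a factor \<open>2\<close> for its signs; this builds up \<open>2\<^sup>n n!\<close>.
  If it is zero, both partitions are zero.
\<close>
lemma pairing_eq:
  assumes "finite A" "length lam = card A" "length mu = card A"
    "sorted_wrt (\<ge>) lam" "sorted_wrt (\<ge>) mu"
  shows "pairing A lam mu = (if lam = mu
    then 2 ^ card A * fact (card A) * v_plus t t0 t1 t2 t3 lam * v_zero (part_mult 0 lam) ^ 2 *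
      (integral\<^sup>L (torus_measure (part_mult 0 lam)) (density {..<part_mult 0 lam}) /
        (2 ^ part_mult 0 lam * fact (part_mult 0 lam)))
    else 0)"
  using assms
proof (induction "card A" arbitrary: A lam mu)
  case 0
  then show ?case using pairing_zero[of A 0] by (simp add: v_plus_def v_zero_def)
next
  case (Suc n)
  define J where "J lam = v_zero (part_mult 0 lam) ^ 2 *
      (integral\<^sup>L (torus_measure (part_mult 0 lam)) (density {..<part_mult 0 lam}) /
        (2 ^ part_mult 0 lam * fact (part_mult 0 lam)))" for lam
  have main: "pairing A (l # lam') (m # mu') = (if l # lam' = m # mu'
      then 2 ^ card A * fact (card A) * v_plus t t0 t1 t2 t3 (l # lam') * J (l # lam') else 0)"
    if len: "Suc (length lam') = card A" "Suc (length mu') = card A"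
      and sorted: "sorted_wrt (\<ge>) (l # lam')" "sorted_wrt (\<ge>) (m # mu')" and ml: "m \<le> l"
    for l m lam' mu'
  proof (cases "l = 0")
    case True
    then have "l # lam' = replicate (card A) 0" "m # mu' = replicate (card A) 0"
      using replicate_of_all_zero[of "l # lam'"] replicate_of_all_zero[of "m # mu'"] sorted ml len by auto
    moreover have "v_plus t t0 t1 t2 t3 (replicate (card A) 0) = 1"
      by (simp add: v_plus_def)
    ultimately show ?thesis
      using pairing_zero[OF Suc.prems(1) refl] by (simp add: J_def)
  next
    case False
    have "pairing A (l # lam') (m # mu') = (\<Sum>k\<in>A. 2 * peel_factor l (m # mu') * pairing (A - {k}) lam' mu')"
      using pairing_peel[of l "m # mu'" A lam'] False sorted ml len Suc.prems(1) by fastforce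
    also have "\<dots> = (\<Sum>k\<in>A. 2 * peel_factor l (m # mu') * (if lam' = mu'
        then 2 ^ n * fact n * v_plus t t0 t1 t2 t3 lam' * J lam' else 0))"
    proof (intro sum.cong refl arg_cong2[of _ _ _ _ "(*)"])
      fix k assume "k \<in> A"
      then have "n = card (A - {k})" using Suc.hyps(2) Suc.prems(1) by simp
      then show "pairing (A - {k}) lam' mu' = (if lam' = mu'
          then 2 ^ n * fact n * v_plus t t0 t1 t2 t3 lam' * J lam' else 0)"
        using Suc.hyps(1)[of "A - {k}" lam' mu'] len sorted Suc.hyps(2) Suc.prems(1)
        by (simp add: J_def mult.assoc)
    qed
    also have "\<dots> = of_nat (Suc n) * (2 * peel_factor l (m # mu') * (if lam' = mu'
        then 2 ^ n * fact n * v_plus t t0 t1 t2 t3 lam' * J lam' else 0))"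
      using Suc.hyps(2) by simp
    also have "\<dots> = (if l # lam' = m # mu'
      then 2 ^ card A * fact (card A) * v_plus t t0 t1 t2 t3 (l # lam') * J (l # lam') else 0)"
    proof (cases "l # lam' = m # mu'")
      case True
      have "J (l # lam') = J lam'" using False by (simp add: J_def)
      then show ?thesis
        using True v_plus_Cons[OF sorted(1)] False Suc.hyps(2)[symmetric]
        by (simp add: mult.assoc mult.left_commute del: peel_factor.simps of_nat_Suc)
    qed auto
    finally show ?thesis .
  qed
  obtain l lam' m mu' where eq: "lam = l # lam'" "mu = m # mu'"
    using Suc.hyps(2) Suc.prems(2,3) by (metis Suc_length_conv)
  have "pairing A lam mu = (if lam = mu
      then 2 ^ card A * fact (card A) * v_plus t t0 t1 t2 t3 lam * J lam else 0)"
  proof (cases "m \<le> l")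
    case True
    then show ?thesis using main[of lam' mu' l m] Suc.prems eq by simp
  next
    case False
    then show ?thesis using main[of mu' lam' m l] Suc.prems eq pairing_commute[of A mu lam] by simp
  qed
  then show ?case by (simp add: J_def mult.assoc)
qed

end

theorem theorem2p8:
  fixes n :: nat and t a b t0 t1 t2 t3 :: complex and lam mu :: "nat list"
  assumes "n \<ge> 1"
    and "norm t < 1" and "norm a < 1" and "norm b < 1"
    and "norm t0 < 1" and "norm t1 < 1" and "norm t2 < 1" and "norm t3 < 1"
    and "lam \<in> partitions n" and "mu \<in> partitions n"
  shows "has_bochner_integral (torus_measure n)
           (\<lambda>z. koornwinder_K n t a b t0 t1 t2 t3 lam z * koornwinder_K n t a b t0 t1 t2 t3 mu z
                 * koornwinder_density n t t0 t1 t2 t3 z)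
           (koornwinder_N t t0 t1 t2 t3 lam * (if lam = mu then 1 else 0))"
proof -
  interpret koornwinder t a b t0 t1 t2 t3
    using assms by unfold_locales
  have len: "length lam = n" "length mu = n" and sorted: "sorted_wrt (\<ge>) lam" "sorted_wrt (\<ge>) mu"
    using assms(9,10) by (auto simp: partitions_def)
  let ?v = "v_factor t a b t0 t1 t2 t3"
  let ?c = "1 / (?v lam * ?v mu * (2 ^ n * fact n))"
  let ?P = "\<lambda>z. symsum lam {..<n} z * symsum mu {..<n} z * density {..<n} z"
  have "has_bochner_integral (torus_measure n) ?P (pairing {..<n} lam mu)"
    unfolding pairing_def torus_measure_def
    by (intro has_bochner_integral_integrable integrable_pairing) (simp_all add: len)
  then have "has_bochner_integral (torus_measure n) (\<lambda>z. ?c * ?P z) (?c * pairing {..<n} lam mu)"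
    by (rule has_bochner_integral_mult_right)
  moreover have "koornwinder_K n t a b t0 t1 t2 t3 lam z * koornwinder_K n t a b t0 t1 t2 t3 mu z
      * koornwinder_density n t t0 t1 t2 t3 z = ?c * ?P z" for z
    unfolding koornwinder_K_symsum[OF len(1)] koornwinder_K_symsum[OF len(2)] koornwinder_density_eq by simp
  moreover have "?c * pairing {..<n} lam mu = koornwinder_N t t0 t1 t2 t3 lam * (if lam = mu then 1 else 0)"
  proof (cases "lam = mu")
    case True
    have "koornwinder_N t t0 t1 t2 t3 lam = 1 / v_plus t t0 t1 t2 t3 lam *
      (integral\<^sup>L (torus_measure (part_mult 0 lam)) (density {..<part_mult 0 lam}) /
        (2 ^ part_mult 0 lam * fact (part_mult 0 lam)))"
      unfolding koornwinder_N_def koornwinder_density_eq[abs_def] by simp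
    moreover have "?c * pairing {..<n} lam mu = 1 / v_plus t t0 t1 t2 t3 lam *
      (integral\<^sup>L (torus_measure (part_mult 0 lam)) (density {..<part_mult 0 lam}) /
        (2 ^ part_mult 0 lam * fact (part_mult 0 lam)))"
      using pairing_eq[of "{..<n}" lam mu] len sorted True v_plus_nonzero[of lam] v_zero_nonzero[of "part_mult 0 lam"]
      by (simp add: v_factor_split power2_eq_square)
    ultimately show ?thesis using True by simp
  next
    case False
    then show ?thesis using pairing_eq[of "{..<n}" lam mu] len sorted by simp
  qed
  ultimately show ?thesis by simp
qed

end
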